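(* Let $g_1,g_2\in\mathcal{S}(\mathbb{R}^d)$ with $\|g_1\|_2=\|g_2\|_2=1$ and let $m\in\mathrm{BV}(\mathbb{R}^{2d})$. Then $$\|H^{g_1}_m-H^{g_2}_m\|_{S^1}\le C_{g_1,g_2}\,\mathit{var}(m),$$ where $C_{g_1,g_2}$ depends only on $g_1,g_2$ and $\|\cdot\|_{S^1}$ is the trace norm. In particular, if $\Omega\subseteq\mathbb{R}^{2d}$ has finite measure and finite perimeter, then $$\|H^{g_1}_\Omega-H^{g_2}_\Omega\|_{S^1}\le C_{g_1,g_2}\,|\partial\Omega|_{2d-1}.$$
   Context: For $z=(x,\xi)\in\mathbb{R}^{2d}$, $\pi(z)f(t)=e^{2\pi i\xi\cdot t}f(t-x)$ and $V_gf(z)=\langle f,\pi(z)g\rangle$. For $\|g\|_2=1$ and a symbol $m$ on $\mathbb{R}^{2d}$, the time-frequency localization operator is $H^g_mf=\int_{\mathbb{R}^{2d}}m(z)V_gf(z)\,\pi(z)g\,dz$ on $L^2(\mathbb{R}^d)$, and $H^g_\Omega:=H^g_{1_\Omega}$. $\mathrm{BV}(\mathbb{R}^{2d})$ is the space of real-valued $f\in L^1(\mathbb{R}^{2d})$ whose distributional partial derivatives are finite Radon measures, with $\mathit{var}(f)=\sup\{\int f\,\mathrm{div}\,\varphi:\varphi\in C^1_c(\mathbb{R}^{2d},\mathbb{R}^{2d}),|\varphi(x)|_2\le1\}$. A set $\Omega$ has finite perimeter if $1_\Omega\in\mathrm{BV}$, and $|\partial\Omega|_{2d-1}:=\mathit{var}(1_\Omega)$.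 *)

theory Defs
  imports "HOL-Analysis.Analysis"
begin

fun dderiv :: "'a::euclidean_space list \<Rightarrow> ('a \<Rightarrow> complex) \<Rightarrow> 'a \<Rightarrow> complex" where
  "dderiv [] f = f"
| "dderiv (v # vs) f = (\<lambda>x. frechet_derivative (dderiv vs f) (at x) v)"

definition schwartz :: "('a::euclidean_space \<Rightarrow> complex) \<Rightarrow> bool" where
  "schwartz g \<longleftrightarrow>
     (\<forall>vs. set vs \<subseteq> Basis \<longrightarrow> (\<forall>x. dderiv vs g differentiable (at x))) \<and>
     (\<forall>vs k. set vs \<subseteq> Basis \<longrightarrow>
        bounded (range (\<lambda>x. norm x ^ k * norm (dderiv vs g x))))"

definition in_L2 :: "('a::euclidean_space \<Rightarrow> complex) \<Rightarrow> bool" where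
  "in_L2 f \<longleftrightarrow> f \<in> borel_measurable lebesgue \<and> integrable lebesgue (\<lambda>t. (cmod (f t))\<^sup>2)"

definition l2_inner :: "('a::euclidean_space \<Rightarrow> complex) \<Rightarrow> ('a \<Rightarrow> complex) \<Rightarrow> complex" where
  "l2_inner f h = (\<integral>t. f t * cnj (h t) \<partial>lebesgue)"

definition l2_norm :: "('a::euclidean_space \<Rightarrow> complex) \<Rightarrow> real" where
  "l2_norm f = sqrt (\<integral>t. (cmod (f t))\<^sup>2 \<partial>lebesgue)"

definition tf_shift :: "'a::euclidean_space \<times> 'a \<Rightarrow> ('a \<Rightarrow> complex) \<Rightarrow> 'a \<Rightarrow> complex" where
  "tf_shift z f t = exp (2 * complex_of_real pi * \<i> * complex_of_real (snd z \<bullet> t)) * f (t - fst z)"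

definition stft :: "('a::euclidean_space \<Rightarrow> complex) \<Rightarrow> ('a \<Rightarrow> complex) \<Rightarrow> 'a \<times> 'a \<Rightarrow> complex" where
  "stft g f z = l2_inner f (tf_shift z g)"

definition loc_op :: "('a::euclidean_space \<Rightarrow> complex) \<Rightarrow> ('a \<times> 'a \<Rightarrow> real) \<Rightarrow> ('a \<Rightarrow> complex) \<Rightarrow> 'a \<Rightarrow> complex" where
  "loc_op g m f t = (\<integral>z. complex_of_real (m z) * stft g f z * tf_shift z g t \<partial>lebesgue)"

definition orthonormal_fam :: "nat \<Rightarrow> (nat \<Rightarrow> 'a::euclidean_space \<Rightarrow> complex) \<Rightarrow> bool" where
  "orthonormal_fam n e \<longleftrightarrow> (\<forall>i<n. in_L2 (e i)) \<and>
     (\<forall>i<n. \<forall>j<n. l2_inner (e i) (e j) = (if i = j then 1 else 0))"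

text \<open>Trace norm (Schatten-1 norm), as an extended real (infinity if not trace class):
  ||T||_{S^1} = sup over orthonormal families (e_i), (f_i) of sum |<T e_i, f_i>|.\<close>
definition trace_norm :: "(('a::euclidean_space \<Rightarrow> complex) \<Rightarrow> ('a \<Rightarrow> complex)) \<Rightarrow> ereal" where
  "trace_norm T = (SUP (n, e, f) \<in> {(n, e, f). orthonormal_fam n e \<and> orthonormal_fam n f}.
      ereal (\<Sum>i<n. cmod (l2_inner (T (e i)) (f i))))"

definition C1c :: "('a::euclidean_space \<Rightarrow> 'b::real_normed_vector) \<Rightarrow> bool" where
  "C1c \<phi> \<longleftrightarrow> (\<forall>x. \<phi> differentiable (at x)) \<and>
     (\<forall>v. continuous_on UNIV (\<lambda>x. frechet_derivative \<phi> (at x) v)) \<and>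
     compact (closure {x. \<phi> x \<noteq> 0})"

definition divergence :: "('a::euclidean_space \<Rightarrow> 'a) \<Rightarrow> 'a \<Rightarrow> real" where
  "divergence \<phi> x = (\<Sum>i\<in>Basis. frechet_derivative \<phi> (at x) i \<bullet> i)"

definition var :: "('a::euclidean_space \<Rightarrow> real) \<Rightarrow> real" where
  "var f = (SUP \<phi> \<in> {\<phi>. C1c \<phi> \<and> (\<forall>x. norm (\<phi> x) \<le> 1)}. \<integral>x. f x * divergence \<phi> x \<partial>lebesgue)"

text \<open>BV: real L1 functions whose distributional partial derivatives are finite
  (signed) Radon measures, i.e. differences of finite Borel measures.\<close>
definition BV :: "('a::euclidean_space \<Rightarrow> real) \<Rightarrow> bool" where
  "BV f \<longleftrightarrow> integrable lebesgue f \<and>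
     (\<forall>i\<in>Basis. \<exists>\<mu> \<nu>. finite_measure \<mu> \<and> finite_measure \<nu> \<and>
        sets \<mu> = sets borel \<and> sets \<nu> = sets borel \<and>
        (\<forall>\<phi>::'a \<Rightarrow> real. C1c \<phi> \<longrightarrow>
           (\<integral>x. f x * frechet_derivative \<phi> (at x) i \<partial>lebesgue)
             = - ((\<integral>x. \<phi> x \<partial>\<mu>) - (\<integral>x. \<phi> x \<partial>\<nu>))))"

end

theory Submission
  imports Defs "HOL-Probability.Probability"
begin

text \<open>
  Write \<open>V w = stft g2 g1 w\<close>. Fourier inversion gives \<open>g1 = \<integral> V w \<pi>(w) g2 dw\<close>, and likewise
  \<open>g2 = \<integral> cnj (V w) \<pi>(w)\<^sup>* g1 dw\<close>. Insert the first expansion into the second factor of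
  \<open>\<langle>e, \<pi>(z) g1\<rangle> \<langle>\<pi>(z) g1, f\<rangle>\<close> and the second one into the first factor of
  \<open>\<langle>e, \<pi>(z) g2\<rangle> \<langle>\<pi>(z) g2, f\<rangle>\<close>. Up to a phase both become \<open>\<integral> V w K\<^sub>w dw\<close> for the same kernel
  \<open>K\<^sub>w(z) = \<langle>e, \<pi>(z) g1\<rangle> \<langle>\<pi>(z + w) g2, f\<rangle>\<close>, evaluated at \<open>z\<close> in the first case and at \<open>z - w\<close> in the
  second. Hence the matrix coefficient of the difference of the two operators is
  \<open>\<integral> V w \<integral> (m z - m (z + w)) K\<^sub>w(z) dz dw\<close>. Bessel's inequality bounds the sum of \<open>|K\<^sub>w(z)|\<close> over
  orthonormal families by 1, and \<open>\<integral> |m z - m (z + w)| dz \<le> |w| var m\<close>, so that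
  \<open>C = \<integral> |w| |V w| dw\<close> works. It is finite because \<open>V\<close> decays rapidly.
\<close>

subsection \<open>Variation and translation\<close>

text \<open>The trace norm is a supremum over finite orthonormal families, so the whole estimate is
  about finite sums of matrix coefficients. The sum is moved inside both integrals before anything
  is estimated: for fixed \<open>w\<close> and \<open>z\<close> Bessel's inequality gives a bound
  independent of the number of vectors, while a bound for each coefficient separately would grow
  with that number. The two expansions share one coefficient function because exchanging signal and
  window reflects \<open>w\<close> and costs only a phase. The phases of the two kernels then agree
  exactly, which is what allows \<open>m z - m (z + w)\<close> to be factored out before absolute
  values are taken. The estimate for translates of \<open>m\<close> is obtained by duality, with the
  derivative placed on the test function. Two features of the definitions shape the rest. They speak
  of Lebesgue measurability, whereas Fubini arguments are convenient for Borel functions; hence the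
  work is done on Borel representatives and transferred at the end. And \<open>var\<close> is a
  real-valued supremum, so the measure derivatives in \<open>BV\<close> have to supply its
  boundedness before it can serve as an upper bound.\<close>

lemma C1c_has_derivative:
  assumes "C1c \<phi>"
  shows "(\<phi> has_derivative frechet_derivative \<phi> (at x)) (at x)"
  using assms unfolding C1c_def frechet_derivative_works[symmetric] by blast

lemma C1cI:
  fixes \<phi> :: "'a::euclidean_space \<Rightarrow> 'b::real_normed_vector"
  assumes d: "\<And>x. (\<phi> has_derivative \<phi>' x) (at x)"
    and c: "\<And>v. continuous_on UNIV (\<lambda>x. \<phi>' x v)"
    and z: "\<And>x. norm x > R \<Longrightarrow> \<phi> x = 0"
  shows "C1c \<phi>"
  unfolding C1c_def
proof (intro conjI allI)
  fix x show "\<phi> differentiable (at x)" using d by (auto simp: differentiable_def)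
next
  fix v
  have "frechet_derivative \<phi> (at x) = \<phi>' x" for x
    using frechet_derivative_at[OF d] by simp
  then show "continuous_on UNIV (\<lambda>x. frechet_derivative \<phi> (at x) v)" using c by simp
next
  have "{x. \<phi> x \<noteq> 0} \<subseteq> cball 0 R" using z by (force simp: not_le)
  then have "bounded {x. \<phi> x \<noteq> 0}" using bounded_cball bounded_subset by blast
  then show "compact (closure {x. \<phi> x \<noteq> 0})" by simp
qed

lemma C1c_continuous:
  assumes "C1c \<phi>" shows "continuous_on UNIV \<phi>"
  using C1c_has_derivative[OF assms] has_derivative_continuous continuous_at_imp_continuous_on
  by blast

lemma C1c_continuous_deriv:
  assumes "C1c \<phi>" shows "continuous_on UNIV (\<lambda>x. frechet_derivative \<phi> (at x) v)"
  using assms by (auto simp: C1c_def)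

text \<open>Outside a ball that contains the support, \<phi> agrees with zero on an open set; hence
  one radius serves the function and all its directional derivatives.\<close>

lemma C1c_support:
  fixes \<phi> :: "'a::euclidean_space \<Rightarrow> 'b::real_normed_vector"
  assumes "C1c \<phi>"
  obtains R where "\<And>x. norm x > R \<Longrightarrow> \<phi> x = 0" "\<And>x v. norm x > R \<Longrightarrow> frechet_derivative \<phi> (at x) v = 0"
proof -
  have "bounded (closure {x. \<phi> x \<noteq> 0})" using assms compact_imp_bounded by (auto simp: C1c_def)
  then obtain R where R: "\<And>x. x \<in> closure {x. \<phi> x \<noteq> 0} \<Longrightarrow> norm x \<le> R"
    by (auto simp: bounded_iff)
  have 1: "\<phi> x = 0" if "norm x > R" for x
    using R[of x] that closure_subset[of "{x. \<phi> x \<noteq> 0}"] by force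
  have "frechet_derivative \<phi> (at x) v = 0" if "norm x > R" for x v
  proof -
    have op: "open {x::'a. norm x > R}"
      by (intro open_Collect_less continuous_intros)
    have "((\<lambda>x. 0) has_derivative frechet_derivative \<phi> (at x)) (at x)"
      by (rule has_derivative_transform_within_open[OF C1c_has_derivative[OF assms] op])
        (use that 1 in auto)
    then have "frechet_derivative \<phi> (at x) = (\<lambda>h. 0)"
      using frechet_derivative_at frechet_derivative_const by fastforce
    then show ?thesis by simp
  qed
  with 1 show ?thesis using that by blast
qed

lemma C1c_deriv_bounded:
  fixes \<phi> :: "'a::euclidean_space \<Rightarrow> 'b::real_normed_vector"
  assumes "C1c \<phi>"
  obtains B where "\<And>x. norm (frechet_derivative \<phi> (at x) v) \<le> B"
proof -
  let ?D = "\<lambda>x. frechet_derivative \<phi> (at x) v"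
  obtain R where R: "\<And>x v. norm x > R \<Longrightarrow> frechet_derivative \<phi> (at x) v = 0"
    using C1c_support[OF assms] by metis
  have "bounded (?D ` cball 0 R)"
    by (intro compact_imp_bounded compact_continuous_image
        continuous_on_subset[OF C1c_continuous_deriv[OF assms]]) auto
  then obtain B where B: "\<And>x. norm x \<le> R \<Longrightarrow> norm (?D x) \<le> B"
    unfolding bounded_iff by (metis imageI mem_cball_0)
  have "norm (?D x) \<le> max B 0" for x
    using B[of x] R[of x v] by (cases "norm x \<le> R") auto
  then show ?thesis using that by blast
qed

lemma divergence_eq:
  assumes "(\<phi> has_derivative \<phi>') (at x)"
  shows "divergence \<phi> x = (\<Sum>i\<in>Basis. \<phi>' i \<bullet> i)"
  using frechet_derivative_at[OF assms] by (simp add: divergence_def)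

text \<open>The derivative of \<open>\<psi> x *\<^sub>R w\<close> is the rank-one map
  \<open>h \<mapsto> \<psi>' h *\<^sub>R w\<close>, whose trace is \<open>\<psi>' w\<close>. This
  converts directional derivatives of scalar test functions into divergences, the quantities that
  occur in \<open>var\<close>.\<close>

lemma divergence_scaleR_const:
  fixes \<psi> :: "'a::euclidean_space \<Rightarrow> real"
  assumes "(\<psi> has_derivative \<psi>') (at x)"
  shows "divergence (\<lambda>x. \<psi> x *\<^sub>R w) x = \<psi>' w"
proof -
  have "((\<lambda>x. \<psi> x *\<^sub>R w) has_derivative (\<lambda>h. \<psi>' h *\<^sub>R w)) (at x)"
    by (rule has_derivative_scaleR_left[OF assms])
  then have "divergence (\<lambda>x. \<psi> x *\<^sub>R w) x = (\<Sum>i\<in>Basis. (w \<bullet> i) * \<psi>' i)"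
    by (simp add: divergence_eq mult.commute)
  also have "\<dots> = \<psi>' (\<Sum>i\<in>Basis. (w \<bullet> i) *\<^sub>R i)"
    using has_derivative_linear[OF assms]
    by (simp add: linear_sum linear_cmul)
  finally show ?thesis by (simp add: euclidean_representation)
qed

text \<open>The outer square makes the truncation continuously differentiable.\<close>
lemma C1c_cutoff:
  fixes p :: "'a::euclidean_space \<Rightarrow> real"
  assumes p: "polynomial_function p" and R: "R > 0"
  shows "C1c (\<lambda>x. (max 0 (1 - (norm x / R)\<^sup>2))\<^sup>2 * p x)"
proof -
  \<comment> \<open>Away from zero the function is locally \<open>0\<close> or
    \<open>s\<^sup>2\<close>; at zero its difference quotient is at most
    \<open>\<bar>x\<bar>\<close> in modulus.\<close>
  have sq: "((\<lambda>s::real. (max 0 s)\<^sup>2) has_field_derivative 2 * max 0 s) (at s)" for s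
  proof (cases "s = 0")
    case True
    have "((\<lambda>s::real. (max 0 s)\<^sup>2) has_field_derivative 0) (at 0)"
      unfolding has_field_derivative_iff
    proof (rule Lim_null_comparison)
      show "\<forall>\<^sub>F x in at 0. norm (((max 0 x)\<^sup>2 - (max 0 0)\<^sup>2) / (x - 0)) \<le> \<bar>x::real\<bar>"
        by (rule eventuallyI) (auto simp: max_def power2_eq_square)
      show "((\<lambda>x::real. \<bar>x\<bar>) \<longlongrightarrow> 0) (at 0)" by (intro tendsto_eq_intros) auto
    qed
    then show ?thesis using True by simp
  next
    case False
    show ?thesis
    proof (cases "s < 0")
      case True
      have "((\<lambda>s::real. 0) has_field_derivative 2 * max 0 s) (at s)" using True by simp
      then show ?thesis
        by (rule DERIV_cong_ev[THEN iffD1, rotated -1])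
          (use True eventually_at_left_field in \<open>auto simp: eventually_nhds max_def intro!: exI[of _ "{..<0}"]\<close>)
    next
      case F2: False
      have "((\<lambda>s::real. s\<^sup>2) has_field_derivative 2 * max 0 s) (at s)"
        using F2 by (auto intro!: derivative_eq_intros)
      then show ?thesis
        by (rule DERIV_cong_ev[THEN iffD1, rotated -1])
          (use False F2 in \<open>auto simp: eventually_nhds max_def intro!: exI[of _ "{0<..}"]\<close>)
    qed
  qed
  define q where "q x = 1 - (norm x / R)\<^sup>2" for x :: 'a
  have q_eq: "q = (\<lambda>x. 1 - (x \<bullet> x) / R\<^sup>2)"
    by (auto simp: q_def power_divide power2_norm_eq_inner)
  have dq: "(q has_derivative (\<lambda>h. - (2 * (x \<bullet> h)) / R\<^sup>2)) (at x)" for x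
    unfolding q_eq using R
    by (auto intro!: derivative_eq_intros simp: inner_commute fun_eq_iff field_simps power2_eq_square power4_eq_xxxx)
  \<comment> \<open>Induction over sums and products of linear forms and constants delivers,
    together with a derivative, its continuity in the base point for each direction, as
    \<open>C1c\<close> demands.\<close>
  obtain p' where p': "\<And>x. (p has_derivative p' x) (at x)" "\<And>v. continuous_on UNIV (\<lambda>x. p' x v)"
  proof -
    have pr: "real_polynomial_function p" using p by (simp add: real_polynomial_function_eq)
    then have "\<exists>p'. (\<forall>x. (p has_derivative p' x) (at x)) \<and> (\<forall>v. continuous_on UNIV (\<lambda>x. p' x v))"
    proof induction
      case (linear f)
      then show ?case
        by (intro exI[of _ "\<lambda>_. f"]) (auto intro: bounded_linear_imp_has_derivative)
    next
      case (const c)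
      then show ?case by (intro exI[of _ "\<lambda>_ _. 0"]) auto
    next
      case (add f g)
      then obtain f' g' where "\<And>x. (f has_derivative f' x) (at x)" "\<And>v. continuous_on UNIV (\<lambda>x. f' x v)"
        "\<And>x. (g has_derivative g' x) (at x)" "\<And>v. continuous_on UNIV (\<lambda>x. g' x v)" by blast
      then show ?case
        by (intro exI[of _ "\<lambda>x v. f' x v + g' x v"]) (auto intro!: has_derivative_add continuous_intros)
    next
      case (mult f g)
      then obtain f' g' where *: "\<And>x. (f has_derivative f' x) (at x)" "\<And>v. continuous_on UNIV (\<lambda>x. f' x v)"
        "\<And>x. (g has_derivative g' x) (at x)" "\<And>v. continuous_on UNIV (\<lambda>x. g' x v)" by blast
      have "continuous_on UNIV f" "continuous_on UNIV g"
        using mult(1,2) by (auto intro!: continuous_at_imp_continuous_on continuous_real_polymonial_function)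
      with * show ?case
        by (intro exI[of _ "\<lambda>x v. f x * g' x v + f' x v * g x"]) (auto intro!: has_derivative_mult continuous_intros)
    qed
    then show ?thesis using that by blast
  qed
  show ?thesis
  proof (rule C1cI)
    fix x
    have "((\<lambda>x. (max 0 (q x))\<^sup>2) has_derivative (\<lambda>h. (- (2 * (x \<bullet> h)) / R\<^sup>2) *  (2 * max 0 (q x)))) (at x)"
      by (rule has_derivative_compose[OF dq sq[unfolded has_field_derivative_def], THEN has_derivative_eq_rhs])
         (auto simp: fun_eq_iff)
    from has_derivative_mult[OF this p'(1)]
    show "((\<lambda>x. (max 0 (1 - (norm x / R)\<^sup>2))\<^sup>2 * p x) has_derivative
      (\<lambda>h. (max 0 (q x))\<^sup>2 * p' x h + (- (2 * (x \<bullet> h)) / R\<^sup>2) *  (2 * max 0 (q x)) * p x)) (at x)"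
      by (simp add: q_def)
  next
    fix v
    have "continuous_on UNIV p" using p'(1) has_derivative_continuous continuous_at_imp_continuous_on by blast
    then show "continuous_on UNIV (\<lambda>x. (max 0 (q x))\<^sup>2 * p' x v + (- (2 * (x \<bullet> v)) / R\<^sup>2) *  (2 * max 0 (q x)) * p x)"
      unfolding q_eq by (intro continuous_intros p'(2)) (use R in auto)
  next
    fix x :: 'a assume "norm x > R"
    then have "norm x / R \<ge> 1" using R by simp
    then have "(norm x / R)\<^sup>2 \<ge> 1" by (rule one_le_power)
    then show "(max 0 (1 - (norm x / R)\<^sup>2))\<^sup>2 * p x = 0" by simp
  qed
qed

text \<open>Duality for the L^1 norm: test functions bounded by 1 are constructed that converge
  almost everywhere to \<open>sgn (u x)\<close>, and dominated convergence with majorant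
  \<open>\<bar>u x\<bar>\<close> carries the bound \<open>B\<close> to the limit.\<close>

lemma integral_norm_le_of_C1c:
  fixes u :: "'a::euclidean_space \<Rightarrow> real"
  assumes u: "integrable lborel u"
    and B: "\<And>\<psi>. C1c \<psi> \<Longrightarrow> (\<And>x. \<bar>\<psi> x\<bar> \<le> 1) \<Longrightarrow> (\<integral>x. u x * \<psi> x \<partial>lborel) \<le> B"
  shows "(\<integral>x. \<bar>u x\<bar> \<partial>lborel) \<le> B"
proof -
  have [measurable]: "u \<in> borel_measurable borel" using u by auto
  have "(\<lambda>x. sgn (u x)) \<in> borel_measurable lborel" unfolding sgn_if by measurable
  then have "(\<lambda>x. sgn (u x)) \<in> borel_measurable lebesgue" by (rule measurable_completion)
  then have "(\<lambda>x. sgn (u x)) measurable_on UNIV"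
    using measurable_on_iff_borel_measurable[of UNIV "\<lambda>x. sgn (u x)"] by simp
  \<comment> \<open>Measurability of the sign supplies continuous functions that converge to it off
    a null set. They are clipped to [-1, 1], replaced by polynomials on growing balls and finally
    cut off.\<close>
  then obtain N g where N: "negligible N" and g: "\<And>n. continuous_on UNIV (g n)"
    and lim: "\<And>x. x \<notin> N \<Longrightarrow> (\<lambda>n. g n x) \<longlonglongrightarrow> sgn (u x)"
    unfolding measurable_on_def by auto
  define G where "G n x = max (-1) (min 1 (g n x))" for n x
  have G: "continuous_on UNIV (G n)" "\<bar>G n x\<bar> \<le> 1" for n x
    unfolding G_def by (intro continuous_intros g) (auto simp: max_def min_def)
  have "\<exists>p. polynomial_function p \<and> (\<forall>x\<in>cball 0 (real (Suc n)). norm (G n x - p x) < 1 / Suc n)" for n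
    by (rule Stone_Weierstrass_polynomial_function)
      (auto intro: continuous_on_subset[OF G(1)])
  then obtain p where p: "\<And>n. polynomial_function (p n)"
    "\<And>n x. norm x \<le> Suc n \<Longrightarrow> \<bar>G n x - p n x\<bar> < 1 / Suc n"
    by (metis mem_cball_0 real_norm_def)
  define ch where "ch n x = (max 0 (1 - (norm x / real (Suc n))\<^sup>2))\<^sup>2" for n and x :: 'a
  have ch01: "0 \<le> ch n x" "ch n x \<le> 1" for n x
    by (auto simp: ch_def intro!: power_le_one)
  have ch0: "ch n x = 0" if "norm x > Suc n" for n x
  proof -
    have "1 \<le> norm x / real (Suc n)" using that by (simp add: field_simps)
    then have "1 \<le> (norm x / real (Suc n))\<^sup>2" by (rule one_le_power)
    then show ?thesis by (simp add: ch_def)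
  qed
  \<comment> \<open>On the ball of radius \<open>Suc n\<close> the polynomial leaves [-1, 1] by less
    than \<open>1 / Suc n\<close>, hence the divisor; off the ball \<open>ch n\<close> vanishes. So
    the bound 1 holds everywhere, and cutoff and divisor both tend to 1 pointwise.\<close>
  define \<psi> where "\<psi> n x = ch n x * (p n x / (1 + 1 / real (Suc n)))" for n x
  have C: "C1c (\<psi> n)" for n
  proof -
    have "polynomial_function (\<lambda>x. p n x / (1 + 1 / real (Suc n)))"
      using p(1)[of n] unfolding real_polynomial_function_eq[symmetric] by (rule real_polynomial_function_divide)
    from C1c_cutoff[OF this, of "real (Suc n)"] show ?thesis by (simp add: \<psi>_def[abs_def] ch_def)
  qed
  have b: "\<bar>\<psi> n x\<bar> \<le> 1" for n x
  proof (cases "norm x \<le> Suc n")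
    case True
    have "\<bar>p n x\<bar> \<le> 1 + 1 / real (Suc n)" using p(2)[OF True] G(2)[of n x] by linarith
    moreover have "0 < 1 + 1 / real (Suc n)" by (simp add: add_pos_pos)
    ultimately have "\<bar>p n x / (1 + 1 / real (Suc n))\<bar> \<le> 1" by (simp add: abs_div)
    then show ?thesis using ch01[of n x] unfolding \<psi>_def abs_mult
      by (intro mult_le_one) auto
  next
    case False then show ?thesis using ch0[of n x] by (simp add: \<psi>_def)
  qed
  have lim\<psi>: "(\<lambda>n. \<psi> n x) \<longlonglongrightarrow> sgn (u x)" if "x \<notin> N" for x
  proof -
    have inv: "(\<lambda>n. 1 / real (Suc n)) \<longlonglongrightarrow> 0" using LIMSEQ_inverse_real_of_nat by (simp add: inverse_eq_divide)
    have "(\<lambda>n. ch n x) \<longlonglongrightarrow> (max 0 (1 - (norm x * 0)\<^sup>2))\<^sup>2"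
      unfolding ch_def using tendsto_mult[OF tendsto_const[of "norm x"] inv]
      by (intro tendsto_intros) simp
    then have c: "(\<lambda>n. ch n x) \<longlonglongrightarrow> 1" by simp
    have "(\<lambda>n. G n x) \<longlonglongrightarrow> max (-1) (min 1 (sgn (u x)))"
      unfolding G_def by (intro tendsto_intros lim that)
    then have Gl: "(\<lambda>n. G n x) \<longlonglongrightarrow> sgn (u x)" by (simp add: sgn_if split: if_splits)
    have "(\<lambda>n. p n x - G n x) \<longlonglongrightarrow> 0"
    proof (rule Lim_null_comparison[OF _ inv])
      obtain n0 where "norm x \<le> real n0" using real_arch_simple by blast
      then show "\<forall>\<^sub>F n in sequentially. norm (p n x - G n x) \<le> 1 / real (Suc n)"
        using p(2)[of x] unfolding eventually_sequentially
        by (intro exI[of _ n0] allI impI) (force simp: abs_minus_commute intro: less_imp_le)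
    qed
    from tendsto_add[OF this Gl] have pl: "(\<lambda>n. p n x) \<longlonglongrightarrow> sgn (u x)" by simp
    have "(\<lambda>n. \<psi> n x) \<longlonglongrightarrow> 1 * (sgn (u x) / (1 + 0))"
      unfolding \<psi>_def by (intro tendsto_intros c pl inv) simp
    then show ?thesis by simp
  qed
  have m\<psi>[measurable]: "\<psi> n \<in> borel_measurable borel" for n
    using C1c_continuous[OF C] by (rule borel_measurable_continuous_onI)
  have "AE x in lebesgue. x \<notin> N"
    using N by (simp add: negligible_iff_null_sets AE_not_in)
  then have AE: "AE x in lborel. x \<notin> N" by (simp add: AE_completion_iff)
  have "(\<lambda>n. \<integral>x. u x * \<psi> n x \<partial>lborel) \<longlonglongrightarrow> (\<integral>x. \<bar>u x\<bar> \<partial>lborel)"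
  proof (rule integral_dominated_convergence[where w="\<lambda>x. \<bar>u x\<bar>"])
    show "AE x in lborel. (\<lambda>n. u x * \<psi> n x) \<longlonglongrightarrow> \<bar>u x\<bar>"
      using AE by (rule AE_mp) (auto intro!: AE_I2 simp: abs_sgn intro!: tendsto_mult lim\<psi>)
    show "AE x in lborel. norm (u x * \<psi> n x) \<le> \<bar>u x\<bar>" for n
      using b by (auto intro!: AE_I2 simp: abs_mult mult_left_le)
  qed (use u in auto)
  then show ?thesis by (rule LIMSEQ_le_const2) (use B[OF C b] in auto)
qed

section \<open>Translation differences controlled by the variation\<close>

lemma lborel_translation:
  fixes f :: "'a::euclidean_space \<Rightarrow> 'b::{banach,second_countable_topology}"
  assumes [measurable]: "f \<in> borel_measurable borel"
  shows "(\<integral>x. f (x + c) \<partial>lborel) = (\<integral>x. f x \<partial>lborel)"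
    and "integrable lborel (\<lambda>x. f (x + c)) \<longleftrightarrow> integrable lborel f"
proof -
  have "(\<integral>x. f x \<partial>lborel) = (\<integral>x. f x \<partial>distr lborel borel ((+) c))"
    by (simp add: lborel_distr_plus)
  also have "\<dots> = (\<integral>x. f (x + c) \<partial>lborel)"
    by (subst integral_distr) (auto simp: add.commute)
  finally show "(\<integral>x. f (x + c) \<partial>lborel) = (\<integral>x. f x \<partial>lborel)" ..
  have "integrable lborel f \<longleftrightarrow> integrable (distr lborel borel ((+) c)) f"
    by (simp add: lborel_distr_plus)
  also have "\<dots> \<longleftrightarrow> integrable lborel (\<lambda>x. f (x + c))"
    by (subst integrable_distr_eq) (auto simp: add.commute)
  finally show "integrable lborel (\<lambda>x. f (x + c)) \<longleftrightarrow> integrable lborel f" ..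
qed

text \<open>With \<open>v\<close> the unit vector along \<open>w\<close>, the field
  \<open>\<psi> x *\<^sub>R v\<close> has norm at most 1 and divergence equal to the derivative of
  \<psi> along \<open>v\<close>; linearity in the direction yields the factor \<open>norm w\<close>.
  The bound \<open>L\<close> is kept abstract so that a Borel representative can be used with the
  variation of the original function.\<close>

lemma integral_deriv_le:
  fixes m :: "'a::euclidean_space \<Rightarrow> real"
  assumes L: "\<And>\<phi>. C1c \<phi> \<Longrightarrow> (\<And>x. norm (\<phi> x) \<le> 1) \<Longrightarrow> (\<integral>x. m x * divergence \<phi> x \<partial>lborel) \<le> L"
    and \<psi>: "C1c \<psi>" "\<And>x. \<bar>\<psi> x\<bar> \<le> 1"
  shows "(\<integral>x. m x * frechet_derivative \<psi> (at x) w \<partial>lborel) \<le> norm w * L"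
proof (cases "w = 0")
  case True
  then show ?thesis
    using linear_0[OF has_derivative_linear[OF C1c_has_derivative[OF \<psi>(1)]]] by simp
next
  case False
  define v where "v = w /\<^sub>R norm w"
  have w: "w = norm w *\<^sub>R v" "norm v = 1" using False by (auto simp: v_def)
  note d = C1c_has_derivative[OF \<psi>(1)]
  obtain R where R: "\<And>x. norm x > R \<Longrightarrow> \<psi> x = 0" using C1c_support[OF \<psi>(1)] by metis
  have C: "C1c (\<lambda>x. \<psi> x *\<^sub>R v)"
    by (rule C1cI[OF has_derivative_scaleR_left[OF d]])
      (auto intro!: continuous_intros C1c_continuous_deriv \<psi>(1) R)
  have "(\<integral>x. m x * divergence (\<lambda>x. \<psi> x *\<^sub>R v) x \<partial>lborel) \<le> L"
    by (rule L[OF C]) (use \<psi>(2) w(2) in auto)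
  then have *: "(\<integral>x. m x * frechet_derivative \<psi> (at x) v \<partial>lborel) \<le> L"
    by (simp add: divergence_scaleR_const[OF d])
  have "(\<integral>x. m x * frechet_derivative \<psi> (at x) w \<partial>lborel)
      = (\<integral>x. norm w * (m x * frechet_derivative \<psi> (at x) v) \<partial>lborel)"
    by (subst w(1), subst linear_cmul[OF has_derivative_linear[OF d]]) (simp add: mult_ac)
  also have "\<dots> = norm w * (\<integral>x. m x * frechet_derivative \<psi> (at x) v \<partial>lborel)" by simp
  also have "\<dots> \<le> norm w * L" using * by (intro mult_left_mono) auto
  finally show ?thesis .
qed

lemma C1c_translate:
  assumes \<psi>: "C1c \<psi>"
  shows "C1c (\<lambda>x. \<psi> (x - a))"
    and "frechet_derivative (\<lambda>x. \<psi> (x - a)) (at x) = frechet_derivative \<psi> (at (x - a))"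
proof -
  have d: "((\<lambda>x. \<psi> (x - a)) has_derivative frechet_derivative \<psi> (at (x - a))) (at x)" for x
    by (rule has_derivative_compose[OF _ C1c_has_derivative[OF \<psi>], of "\<lambda>x. x - a" "\<lambda>h. h" x UNIV])
      (auto intro!: derivative_eq_intros)
  then show "frechet_derivative (\<lambda>x. \<psi> (x - a)) (at x) = frechet_derivative \<psi> (at (x - a))"
    by (rule frechet_derivative_at[symmetric])
  obtain R where R: "\<And>x. norm x > R \<Longrightarrow> \<psi> x = 0" using C1c_support[OF \<psi>(1)] by metis
  show "C1c (\<lambda>x. \<psi> (x - a))"
  proof (rule C1cI[OF d])
    show "continuous_on UNIV (\<lambda>x. frechet_derivative \<psi> (at (x - a)) v)" for v
      by (rule continuous_on_compose2[OF C1c_continuous_deriv[OF \<psi>]]) (auto intro: continuous_intros)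
    show "\<psi> (x - a) = 0" if "norm x > R + norm a" for x
      by (rule R) (use that norm_triangle_ineq2[of x a] in linarith)
  qed
qed

text \<open>Tested against \<psi>, the difference becomes \<open>h 1 - h 0\<close>, where
  \<open>h t\<close> pairs \<open>m\<close> with \<psi> shifted by \<open>t *\<^sub>R w\<close>.
  Differentiation in \<open>t\<close> falls on \<psi>, so \<open>h'\<close> is a pairing of
  \<open>m\<close> with a directional derivative, and the mean value theorem bounds the increment.
  Duality then returns to the L^1 norm.\<close>

lemma integral_translation_diff_le:
  fixes m :: "'a::euclidean_space \<Rightarrow> real"
  assumes m: "integrable lborel m"
    and L: "\<And>\<phi>. C1c \<phi> \<Longrightarrow> (\<And>x. norm (\<phi> x) \<le> 1) \<Longrightarrow> (\<integral>x. m x * divergence \<phi> x \<partial>lborel) \<le> L"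
  shows "(\<integral>x. \<bar>m (x + w) - m x\<bar> \<partial>lborel) \<le> norm w * L"
proof (rule integral_norm_le_of_C1c)
  have [measurable]: "m \<in> borel_measurable borel" using m by auto
  have mw: "integrable lborel (\<lambda>x. m (x + w))" using m by (simp add: lborel_translation)
  show "integrable lborel (\<lambda>x. m (x + w) - m x)" using m mw by simp
  fix \<psi> :: "'a \<Rightarrow> real" assume \<psi>: "C1c \<psi>" "\<And>x. \<bar>\<psi> x\<bar> \<le> 1"
  define D where "D x = frechet_derivative \<psi> (at x)" for x
  have dD: "(\<psi> has_derivative D x) (at x)" for x using C1c_has_derivative[OF \<psi>(1)] by (simp add: D_def)
  have cD: "continuous_on UNIV (\<lambda>x. D x v)" for v using C1c_continuous_deriv[OF \<psi>(1)] by (simp add: D_def)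
  have [measurable]: "\<psi> \<in> borel_measurable borel" "(\<lambda>x. D x v) \<in> borel_measurable borel" for v
    using C1c_continuous[OF \<psi>(1)] cD by (auto intro: borel_measurable_continuous_onI)
  obtain B where B: "\<And>x. norm (D x w) \<le> B" using C1c_deriv_bounded[OF \<psi>(1)] unfolding D_def by metis
  define h where "h t = (\<integral>x. m x * \<psi> (x - t *\<^sub>R w) \<partial>lborel)" for t
  define h' where "h' t = (\<integral>x. m x * - D (x - t *\<^sub>R w) w \<partial>lborel)" for t
  have im: "integrable lborel (\<lambda>x. m x * \<psi> (x - a))" for a
    by (rule Bochner_Integration.integrable_bound[OF integrable_norm[OF m]])
      (use \<psi>(2) in \<open>auto simp: abs_mult mult_left_le\<close>)
  have k: "((\<lambda>r. \<psi> (x - r *\<^sub>R w)) has_field_derivative (- D (x - t *\<^sub>R w) w)) (at t within S)" for x t S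
  proof -
    have "((\<lambda>r. \<psi> (x - r *\<^sub>R w)) has_derivative (\<lambda>u. D (x - t *\<^sub>R w) (- (u *\<^sub>R w)))) (at t within S)"
      by (rule has_derivative_compose[OF _ dD]) (auto intro!: derivative_eq_intros)
    moreover have "D (x - t *\<^sub>R w) (- (u *\<^sub>R w)) = - D (x - t *\<^sub>R w) w * u" for u
      using has_derivative_linear[OF dD] by (simp add: linear_neg linear_cmul)
    ultimately show ?thesis
      unfolding has_field_derivative_def by (elim has_derivative_eq_rhs) (simp add: fun_eq_iff)
  qed
  \<comment> \<open>Differentiation under the integral sign, along sequences so that dominated
    convergence applies: difference quotients of \<psi> are bounded by \<open>B\<close>, whence the
    majorant \<open>\<bar>m x\<bar> * B\<close>.\<close>
  have dh: "(h has_field_derivative h' t) (at t)" for t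
    unfolding has_field_derivative_iff tendsto_at_iff_sequentially comp_def
  proof (intro allI impI)
    fix s assume s: "\<forall>i. s i \<in> UNIV - {t}" "s \<longlonglongrightarrow> t"
    have eq: "(h (s n) - h t) / (s n - t) =
      (\<integral>x. m x * ((\<psi> (x - s n *\<^sub>R w) - \<psi> (x - t *\<^sub>R w)) / (s n - t)) \<partial>lborel)" for n
      unfolding h_def using im by (subst Bochner_Integration.integral_diff[symmetric])
        (auto simp: right_diff_distrib simp flip: integral_divide_zero)
    show "(\<lambda>n. (h (s n) - h t) / (s n - t)) \<longlonglongrightarrow> h' t"
      unfolding eq h'_def
    proof (rule integral_dominated_convergence[where w="\<lambda>x. \<bar>m x\<bar> * B"])
      show "integrable lborel (\<lambda>x. \<bar>m x\<bar> * B)" using m by auto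
      show "AE x in lborel. (\<lambda>n. m x * ((\<psi> (x - s n *\<^sub>R w) - \<psi> (x - t *\<^sub>R w)) / (s n - t)))
          \<longlonglongrightarrow> m x * - D (x - t *\<^sub>R w) w"
      proof (rule AE_I2, rule tendsto_mult[OF tendsto_const])
        fix x
        show "(\<lambda>n. (\<psi> (x - s n *\<^sub>R w) - \<psi> (x - t *\<^sub>R w)) / (s n - t)) \<longlonglongrightarrow> - D (x - t *\<^sub>R w) w"
          using k[of x t UNIV] s
          unfolding has_field_derivative_iff tendsto_at_iff_sequentially comp_def by blast
      qed
      show "AE x in lborel. norm (m x * ((\<psi> (x - s n *\<^sub>R w) - \<psi> (x - t *\<^sub>R w)) / (s n - t))) \<le> \<bar>m x\<bar> * B" for n
      proof (rule AE_I2)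
        fix x
        have "norm (\<psi> (x - s n *\<^sub>R w) - \<psi> (x - t *\<^sub>R w)) \<le> B * norm (s n - t)"
          by (rule field_differentiable_bound[OF convex_UNIV k]) (use B in auto)
        then have "\<bar>(\<psi> (x - s n *\<^sub>R w) - \<psi> (x - t *\<^sub>R w)) / (s n - t)\<bar> \<le> B"
          using s(1) by (auto simp: divide_le_eq)
        then show "norm (m x * ((\<psi> (x - s n *\<^sub>R w) - \<psi> (x - t *\<^sub>R w)) / (s n - t))) \<le> \<bar>m x\<bar> * B"
          by (simp only: real_norm_def abs_mult) (rule mult_left_mono, auto)
      qed
    qed auto
  qed
  have h'_le: "h' t \<le> norm w * L" for t
  proof -
    have lin: "D x (- w) = - D x w" for x using has_derivative_linear[OF dD] by (simp add: linear_neg)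
    \<comment> \<open>The argument \<open>x - t *\<^sub>R w\<close> moves in direction
      \<open>- w\<close>, the origin of the sign in \<open>h'\<close>; the norm of the direction is
      unchanged.\<close>
    have "(\<integral>x. m x * frechet_derivative (\<lambda>x. \<psi> (x - t *\<^sub>R w)) (at x) (- w) \<partial>lborel) \<le> norm (- w) * L"
      by (rule integral_deriv_le[OF L C1c_translate(1)[OF \<psi>(1)]]) (use \<psi>(2) in auto)
    then show ?thesis by (simp add: C1c_translate(2)[OF \<psi>(1)] h'_def lin flip: D_def)
  qed
  obtain z where z: "h 1 - h 0 = (1 - 0) * h' z"
    using MVT2[of 0 1 h h'] dh by auto
  have "(\<integral>x. (m (x + w) - m x) * \<psi> x \<partial>lborel) = (\<integral>x. m (x + w) * \<psi> (x + w - w) - m x * \<psi> x \<partial>lborel)"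
    by (simp add: left_diff_distrib)
  also have "\<dots> = (\<integral>x. m (x + w) * \<psi> (x + w - w) \<partial>lborel) - (\<integral>x. m x * \<psi> x \<partial>lborel)"
    using im[of w] im[of 0] lborel_translation(2)[of "\<lambda>x. m x * \<psi> (x - w)" w]
    by (subst Bochner_Integration.integral_diff) auto
  also have "(\<integral>x. m (x + w) * \<psi> (x + w - w) \<partial>lborel) = (\<integral>x. m x * \<psi> (x - w) \<partial>lborel)"
    by (rule lborel_translation(1)[where f="\<lambda>x. m x * \<psi> (x - w)"]) auto
  finally have "(\<integral>x. (m (x + w) - m x) * \<psi> x \<partial>lborel) = h 1 - h 0" by (simp add: h_def)
  then show "(\<integral>x. (m (x + w) - m x) * \<psi> x \<partial>lborel) \<le> norm w * L"
    using z h'_le[of z] by simp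
qed

subsection \<open>Fourier inversion\<close>

text \<open>Tonelli and Fubini in one step. The majorant controls the inner integral instead of the
  integrand: kernels such as \<open>tf_shift z g t * cnj (f t)\<close> are integrable in
  \<open>t\<close> uniformly in \<open>z\<close>, but come with no evident pointwise bound by a
  product.\<close>

lemma Fubini_bound:
  fixes f :: "'a::euclidean_space \<Rightarrow> 'b::euclidean_space \<Rightarrow> 'c::{banach,second_countable_topology}"
  assumes f[measurable]: "(\<lambda>(x, y). f x y) \<in> borel_measurable (borel \<Otimes>\<^sub>M borel)"
    and i: "\<And>x. integrable lborel (\<lambda>y. f x y)"
    and b: "\<And>x. (\<integral>y. norm (f x y) \<partial>lborel) \<le> p x" and p: "integrable lborel p"
  shows "integrable (lborel \<Otimes>\<^sub>M lborel) (\<lambda>(x, y). f x y)"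
    and "(\<integral>x. \<integral>y. f x y \<partial>lborel \<partial>lborel) = (\<integral>y. \<integral>x. f x y \<partial>lborel \<partial>lborel)"
    and "integrable lborel (\<lambda>x. \<integral>y. f x y \<partial>lborel)"
    and "integrable lborel (\<lambda>y. \<integral>x. f x y \<partial>lborel)"
proof -
  have [measurable]: "(\<lambda>(x, y). f x y) \<in> borel_measurable (lborel \<Otimes>\<^sub>M lborel)"
    using f by (simp cong: measurable_cong_sets sets_pair_measure_cong)
  have ni: "integrable lborel (\<lambda>x. \<integral>y. norm (f x y) \<partial>lborel)"
    by (rule Bochner_Integration.integrable_bound[OF p])
      (auto intro!: AE_I2 order_trans[OF b])
  show I: "integrable (lborel \<Otimes>\<^sub>M lborel) (\<lambda>(x, y). f x y)"
    by (rule lborel_pair.Fubini_integrable) (use i ni in auto)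
  show "(\<integral>x. \<integral>y. f x y \<partial>lborel \<partial>lborel) = (\<integral>y. \<integral>x. f x y \<partial>lborel \<partial>lborel)"
    by (rule lborel_pair.Fubini_integral[OF I, symmetric])
  show "integrable lborel (\<lambda>x. \<integral>y. f x y \<partial>lborel)"
    using lborel_pair.integrable_fst[OF I] .
  show "integrable lborel (\<lambda>y. \<integral>x. f x y \<partial>lborel)"
    using lborel_pair.integrable_snd[OF I] .
qed

lemma Fubini_product_bound:
  fixes f :: "'a::euclidean_space \<Rightarrow> 'b::euclidean_space \<Rightarrow> 'c::{banach,second_countable_topology}"
  assumes f[measurable]: "(\<lambda>(x, y). f x y) \<in> borel_measurable (borel \<Otimes>\<^sub>M borel)"
    and b: "\<And>x y. norm (f x y) \<le> p x * q y"
    and p: "integrable lborel p" and q: "integrable lborel q"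
  shows "integrable (lborel \<Otimes>\<^sub>M lborel) (\<lambda>(x, y). f x y)"
    and "(\<integral>x. \<integral>y. f x y \<partial>lborel \<partial>lborel) = (\<integral>y. \<integral>x. f x y \<partial>lborel \<partial>lborel)"
    and "integrable lborel (\<lambda>x. \<integral>y. f x y \<partial>lborel)"
    and "integrable lborel (\<lambda>y. \<integral>x. f x y \<partial>lborel)"
proof -
  have i: "integrable lborel (\<lambda>y. f x y)" for x
    by (rule Bochner_Integration.integrable_bound[of lborel "\<lambda>y. p x * q y"])
      (use q b in \<open>auto intro!: AE_I2 order_trans[OF b]\<close>)
  have bb: "(\<integral>y. norm (f x y) \<partial>lborel) \<le> p x * (\<integral>y. q y \<partial>lborel)" for x
    using i q by (subst integral_mult_right_zero[symmetric], intro integral_mono b) auto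
  have pp: "integrable lborel (\<lambda>x. p x * (\<integral>y. q y \<partial>lborel))" using p by simp
  note F = Fubini_bound[OF f i bb pp]
  show "integrable (lborel \<Otimes>\<^sub>M lborel) (\<lambda>(x, y). f x y)"
    "(\<integral>x. \<integral>y. f x y \<partial>lborel \<partial>lborel) = (\<integral>y. \<integral>x. f x y \<partial>lborel \<partial>lborel)"
    "integrable lborel (\<lambda>x. \<integral>y. f x y \<partial>lborel)" "integrable lborel (\<lambda>y. \<integral>x. f x y \<partial>lborel)"
    by (rule F)+
qed

text \<open>\<open>lborel\<close> is the image of a product of one-dimensional Lebesgue measures
  under the coordinate map. Gaussians and the comparison function for the weights below have this
  product shape.\<close>

lemma lborel_prod_Basis:
  fixes f :: "'a::euclidean_space \<Rightarrow> real \<Rightarrow> 'b::{real_normed_field,banach,second_countable_topology}"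
  assumes i: "\<And>b. b \<in> Basis \<Longrightarrow> integrable lborel (f b)"
  shows "integrable lborel (\<lambda>x::'a. \<Prod>b\<in>Basis. f b (x \<bullet> b))"
    and "(\<integral>x. (\<Prod>b\<in>Basis. f b (x \<bullet> b)) \<partial>lborel) = (\<Prod>b\<in>Basis. \<integral>x. f b x \<partial>lborel)"
proof -
  interpret product_sigma_finite "\<lambda>_::'a. lborel::real measure" ..
  let ?T = "\<lambda>y::'a \<Rightarrow> real. \<Sum>b\<in>Basis. y b *\<^sub>R b"
  have [measurable]: "f b \<in> borel_measurable borel" if "b \<in> Basis" for b using i[OF that] by auto
  have T: "(\<Prod>b\<in>Basis. f b (?T y \<bullet> b)) = (\<Prod>b\<in>Basis. f b (y b))" for y
    by (rule prod.cong) (simp_all add: inner_sum_left_Basis)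
  have m: "(\<lambda>x::'a. \<Prod>b\<in>Basis. f b (x \<bullet> b)) \<in> borel_measurable borel" by measurable
  have mT: "?T \<in> (\<Pi>\<^sub>M b\<in>Basis. lborel) \<rightarrow>\<^sub>M borel" by measurable
  have "integrable (\<Pi>\<^sub>M b\<in>Basis. lborel) (\<lambda>y. \<Prod>b\<in>Basis. f b (y b))"
    by (rule product_integrable_prod) (use i in auto)
  then show "integrable lborel (\<lambda>x::'a. \<Prod>b\<in>Basis. f b (x \<bullet> b))"
    by (subst lborel_eq, subst integrable_distr_eq[OF mT m]) (simp only: T)
  have "(\<integral>x. (\<Prod>b\<in>Basis. f b (x \<bullet> b)) \<partial>lborel) = (\<integral>y. (\<Prod>b\<in>Basis. f b (y b)) \<partial>(\<Pi>\<^sub>M b\<in>Basis. lborel))"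
    by (subst lborel_eq, subst integral_distr[OF mT m]) (simp only: T)
  also have "\<dots> = (\<Prod>b\<in>Basis. \<integral>x. f b x \<partial>lborel)"
    by (rule product_integral_prod) (use i in auto)
  finally show "(\<integral>x. (\<Prod>b\<in>Basis. f b (x \<bullet> b)) \<partial>lborel) = (\<Prod>b\<in>Basis. \<integral>x. f b x \<partial>lborel)" .
qed

lemma lborel_scale:
  fixes f :: "'a::euclidean_space \<Rightarrow> 'b::{banach,second_countable_topology}"
  assumes [measurable]: "f \<in> borel_measurable borel" and c: "c \<noteq> 0"
  shows "(\<integral>x. f x \<partial>lborel) = \<bar>c\<bar> ^ DIM('a) *\<^sub>R (\<integral>x. f (t + c *\<^sub>R x) \<partial>lborel)"
    and "integrable lborel (\<lambda>x. f (t + c *\<^sub>R x)) \<longleftrightarrow> integrable lborel f"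
proof -
  note a = lborel_affine[OF c, of t]
  show "(\<integral>x. f x \<partial>lborel) = \<bar>c\<bar> ^ DIM('a) *\<^sub>R (\<integral>x. f (t + c *\<^sub>R x) \<partial>lborel)"
    by (subst a) (simp add: integral_density integral_distr)
  show "integrable lborel (\<lambda>x. f (t + c *\<^sub>R x)) \<longleftrightarrow> integrable lborel f"
  proof
    assume "integrable lborel (\<lambda>x. f (t + c *\<^sub>R x))"
    then show "integrable lborel f"
      by (subst a) (simp add: integrable_density integrable_distr_eq)
  next
    assume "integrable lborel f"
    then have "integrable lborel (\<lambda>x. \<bar>c\<bar> ^ DIM('a) *\<^sub>R f (t + c *\<^sub>R x))"
      by (subst (asm) a) (simp add: integrable_density integrable_distr_eq)
    then have "integrable lborel (\<lambda>x. (1 / \<bar>c\<bar> ^ DIM('a)) *\<^sub>R \<bar>c\<bar> ^ DIM('a) *\<^sub>R f (t + c *\<^sub>R x))"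
      by (rule integrable_scaleR_right)
    then show "integrable lborel (\<lambda>x. f (t + c *\<^sub>R x))" using c by simp
  qed
qed

section \<open>The Gaussian and its Fourier transform\<close>

definition gauss :: "'a::euclidean_space \<Rightarrow> real" where
  "gauss x = (\<Prod>b\<in>Basis. std_normal_density (x \<bullet> b))"

lemma norm_power2_eq_sum: "(norm (x::'a::euclidean_space))\<^sup>2 = (\<Sum>b\<in>Basis. (x \<bullet> b)\<^sup>2)"
proof -
  have "(norm x)\<^sup>2 = x \<bullet> x" by (rule power2_norm_eq_inner)
  also have "\<dots> = (\<Sum>b\<in>Basis. (x \<bullet> b) * (x \<bullet> b))" by (rule euclidean_inner)
  finally show ?thesis by (simp only: power2_eq_square)
qed

lemma prod_exp_neg_square:
  "(\<Prod>b\<in>Basis. exp (- (x \<bullet> b)\<^sup>2 / 2)) = exp (- (norm (x::'a::euclidean_space))\<^sup>2 / 2)"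
proof -
  have "(\<Prod>b\<in>Basis. exp (- (x \<bullet> b)\<^sup>2 / 2)) = exp (\<Sum>b\<in>Basis. - (x \<bullet> b)\<^sup>2 / 2)"
    by (rule exp_sum[symmetric]) simp
  also have "(\<Sum>b\<in>Basis. - (x \<bullet> b)\<^sup>2 / 2) = - (\<Sum>b\<in>Basis. (x \<bullet> b)\<^sup>2) / 2"
    by (simp only: sum_divide_distrib[symmetric] sum_negf)
  finally show ?thesis by (simp only: norm_power2_eq_sum)
qed

lemma gauss_eq: "gauss (x::'a::euclidean_space) = exp (- (norm x)\<^sup>2 / 2) / sqrt (2 * pi) ^ DIM('a)"
proof -
  have "gauss x = (\<Prod>b\<in>Basis. exp (- (x \<bullet> b)\<^sup>2 / 2) / sqrt (2 * pi))"
    by (simp add: gauss_def std_normal_density_def)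
  also have "\<dots> = (\<Prod>b\<in>Basis. exp (- (x \<bullet> b)\<^sup>2 / 2)) / sqrt (2 * pi) ^ DIM('a)"
    by (simp only: prod_dividef prod_constant)
  finally show ?thesis by (simp only: prod_exp_neg_square)
qed

lemma gauss_integrable: "integrable lborel (gauss :: 'a::euclidean_space \<Rightarrow> real)"
  and gauss_integral: "(\<integral>x. gauss (x::'a) \<partial>lborel) = 1"
  unfolding gauss_def[abs_def]
  using lborel_prod_Basis[where f="\<lambda>_::'a. std_normal_density"]
  by (auto simp: integrable_normal_density integral_normal_density)

lemma gauss_measurable[measurable]: "gauss \<in> borel_measurable borel"
  using gauss_integrable by auto

text \<open>In each coordinate this is the characteristic function of the standard normal law,
  \<open>exp (- t\<^sup>2 / 2)\<close>, and the product of these is \<open>gauss\<close> up to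
  normalisation. Defining \<open>gauss\<close> as a product is what lets the integral
  factor.\<close>

lemma gauss_fourier:
  fixes y :: "'a::euclidean_space"
  shows "(\<integral>x. complex_of_real (gauss x) * cis (x \<bullet> y) \<partial>lborel)
    = of_real (sqrt (2 * pi) ^ DIM('a) * gauss y)"
proof -
  have one: "(\<integral>x. complex_of_real (std_normal_density x) * cis (x * t) \<partial>lborel) = complex_of_real (exp (- (t\<^sup>2) / 2))"
    and onei: "integrable lborel (\<lambda>x. complex_of_real (std_normal_density x) * cis (x * t))" for t
  proof -
    have "char std_normal_distribution t = (\<integral>x. std_normal_density x *\<^sub>R iexp (t * x) \<partial>lborel)"
      unfolding char_def by (subst integral_density) auto
    then show "(\<integral>x. complex_of_real (std_normal_density x) * cis (x * t) \<partial>lborel) = complex_of_real (exp (- (t\<^sup>2) / 2))"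
      by (simp add: char_std_normal_distribution cis_conv_exp scaleR_conv_of_real mult_ac)
    show "integrable lborel (\<lambda>x. complex_of_real (std_normal_density x) * cis (x * t))"
      by (rule Bochner_Integration.integrable_bound[OF integrable_normal_density[of 1 0]])
        (auto simp: norm_mult cis_conv_exp)
  qed
  have pr: "complex_of_real (gauss x) * cis (x \<bullet> y)
    = (\<Prod>b\<in>Basis. complex_of_real (std_normal_density (x \<bullet> b)) * cis ((x \<bullet> b) * (y \<bullet> b)))" for x
    by (simp add: gauss_def prod.distrib euclidean_inner[of x y] cis_conv_exp sum_distrib_left exp_sum)
  have "(\<integral>x. complex_of_real (gauss x) * cis (x \<bullet> y) \<partial>lborel)
    = (\<Prod>b\<in>Basis. complex_of_real (exp (- (y \<bullet> b)\<^sup>2 / 2)))"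
    unfolding pr by (subst lborel_prod_Basis(2)[OF onei]) (simp only: one)
  also have "\<dots> = complex_of_real (\<Prod>b\<in>Basis. exp (- (y \<bullet> b)\<^sup>2 / 2))" by (simp only: of_real_prod)
  also have "(\<Prod>b\<in>Basis. exp (- (y \<bullet> b)\<^sup>2 / 2)) = sqrt (2 * pi) ^ DIM('a) * gauss y"
    unfolding prod_exp_neg_square gauss_eq by simp
  finally show ?thesis .
qed

text \<open>Gaussian regularisation. With the factor \<open>q c\<close> inserted, Fubini turns the
  integral into an average of \<open>h\<close> against a Gaussian of width \<open>1 / c\<close>
  around \<open>t\<close>. As \<open>c\<close> grows, integrability of the transform gives the limit
  of one side, continuity and boundedness of \<open>h\<close> that of the other.\<close>

lemma fourier_inversion:
  fixes h :: "'a::euclidean_space \<Rightarrow> complex"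
  assumes h: "integrable lborel h" and c: "continuous_on UNIV h" and bd: "\<And>x. norm (h x) \<le> B"
    and F: "integrable lborel (\<lambda>y. \<integral>s. h s * cis (- (2 * pi * (y \<bullet> s))) \<partial>lborel)"
  shows "(\<integral>y. (\<integral>s. h s * cis (- (2 * pi * (y \<bullet> s))) \<partial>lborel) * cis (2 * pi * (y \<bullet> t)) \<partial>lborel) = h t"
proof -
  let ?F = "\<lambda>y. \<integral>s. h s * cis (- (2 * pi * (y \<bullet> s))) \<partial>lborel"
  have [measurable]: "h \<in> borel_measurable borel" using h by auto
  have [measurable]: "cis \<in> borel_measurable borel" 
    by (intro borel_measurable_continuous_onI continuous_intros)
  \<comment> \<open>The scale is chosen so that the Fourier transform of \<open>q c\<close> is the
    approximate identity \<open>c ^ DIM('a) * gauss (c *\<^sub>R (t - s))\<close>; the prefactor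
    normalises \<open>q c 0\<close> to 1.\<close>
  define q where "q c y = sqrt (2 * pi) ^ DIM('a) * gauss ((2 * pi / c) *\<^sub>R y)" for c and y :: 'a
  have q_eq: "q c y = exp (- (2 * pi / c)\<^sup>2 * (norm y)\<^sup>2 / 2)" for c y
    by (simp add: q_def gauss_eq power_mult_distrib power_divide)
  have [measurable]: "q c \<in> borel_measurable borel" for c unfolding q_def by measurable
  have q: "integrable lborel (q c)" if "c > 0" for c
    using that gauss_integrable lborel_scale(2)[of "gauss::'a \<Rightarrow> real" "2 * pi / c" 0]
    by (simp add: q_def[abs_def])
  have key: "(\<integral>y. ?F y * cis (2 * pi * (y \<bullet> t)) * of_real (q c y) \<partial>lborel)
      = (\<integral>u. h (t - (1 / c) *\<^sub>R u) * of_real (gauss u) \<partial>lborel)" if "c > 0" for c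
  proof -
    define d where "d = 2 * pi / c"
    have d: "d > 0" using that by (simp add: d_def)
    have "(\<integral>y. ?F y * cis (2 * pi * (y \<bullet> t)) * of_real (q c y) \<partial>lborel)
      = (\<integral>y. (\<integral>s. h s * cis (- (2 * pi * (y \<bullet> s))) * (cis (2 * pi * (y \<bullet> t)) * of_real (q c y)) \<partial>lborel) \<partial>lborel)"
      by (simp only: mult.assoc integral_mult_left_zero[symmetric])
    also have "\<dots> = (\<integral>s. (\<integral>y. h s * cis (- (2 * pi * (y \<bullet> s))) * (cis (2 * pi * (y \<bullet> t)) * of_real (q c y)) \<partial>lborel) \<partial>lborel)"
      by (rule Fubini_product_bound(2)[where p="q c" and q="\<lambda>s. norm (h s)"])
        (use q[OF that] h in \<open>auto simp: norm_mult q_eq\<close>)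
    also have "\<dots> = (\<integral>s. h s * of_real (c ^ DIM('a) * gauss (c *\<^sub>R (t - s))) \<partial>lborel)"
    proof (rule Bochner_Integration.integral_cong[OF refl])
      fix s
      let ?f = "\<lambda>y. cis (2 * pi * (y \<bullet> (t - s))) * of_real (q c y)"
      have e: "cis (2 * pi * ((1 / d) *\<^sub>R y \<bullet> (t - s))) * complex_of_real (q c ((1 / d) *\<^sub>R y))
        = of_real (sqrt (2 * pi) ^ DIM('a)) * (of_real (gauss y) * cis (y \<bullet> (c *\<^sub>R (t - s))))" for y
      proof -
        have "2 * pi * ((1 / d) *\<^sub>R y \<bullet> (t - s)) = y \<bullet> (c *\<^sub>R (t - s))"
          and "(2 * pi / c) *\<^sub>R (1 / d) *\<^sub>R y = y"
          using that by (simp_all add: d_def)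
        then show ?thesis by (simp only: q_def of_real_mult mult_ac)
      qed
      have "(\<integral>y. h s * cis (- (2 * pi * (y \<bullet> s))) * (cis (2 * pi * (y \<bullet> t)) * of_real (q c y)) \<partial>lborel)
        = (\<integral>y. h s * ?f y \<partial>lborel)"
      proof (intro Bochner_Integration.integral_cong refl)
        fix y
        have "cis (- (2 * pi * (y \<bullet> s))) * cis (2 * pi * (y \<bullet> t)) = cis (2 * pi * (y \<bullet> (t - s)))"
          unfolding cis_mult by (simp add: inner_diff_right algebra_simps)
        then show "h s * cis (- (2 * pi * (y \<bullet> s))) * (cis (2 * pi * (y \<bullet> t)) * of_real (q c y)) = h s * ?f y"
          by (metis mult.assoc)
      qed
      also have "\<dots> = h s * (\<integral>y. ?f y \<partial>lborel)" by simp
      also have "(\<integral>y. ?f y \<partial>lborel) = \<bar>1 / d\<bar> ^ DIM('a) *\<^sub>R (\<integral>y. ?f (0 + (1 / d) *\<^sub>R y) \<partial>lborel)"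
        by (rule lborel_scale) (use d in auto)
      also have "(\<integral>y. ?f (0 + (1 / d) *\<^sub>R y) \<partial>lborel)
        = of_real (sqrt (2 * pi) ^ DIM('a)) * of_real (sqrt (2 * pi) ^ DIM('a) * gauss (c *\<^sub>R (t - s)))"
        unfolding add_0 e integral_mult_right_zero gauss_fourier ..
      also have "\<bar>1 / d\<bar> ^ DIM('a) *\<^sub>R (of_real (sqrt (2 * pi) ^ DIM('a)) * of_real (sqrt (2 * pi) ^ DIM('a) * gauss (c *\<^sub>R (t - s))))
        = complex_of_real (((1 / d) * (sqrt (2 * pi) * sqrt (2 * pi))) ^ DIM('a) * gauss (c *\<^sub>R (t - s)))"
      proof -
        have ab: "\<bar>1 / d\<bar> = 1 / d" using d by simp
        have r: "\<bar>1 / d\<bar> ^ DIM('a) * (sqrt (2 * pi) ^ DIM('a) * (sqrt (2 * pi) ^ DIM('a) * G))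
          = ((1 / d) * (sqrt (2 * pi) * sqrt (2 * pi))) ^ DIM('a) * G" for G
          unfolding ab by (simp only: power_mult_distrib mult.assoc)
        show ?thesis by (simp only: scaleR_conv_of_real of_real_mult[symmetric] r)
      qed
      also have "(1 / d) * (sqrt (2 * pi) * sqrt (2 * pi)) = c"
        using that by (simp add: d_def)
      finally show "(\<integral>y. h s * cis (- (2 * pi * (y \<bullet> s))) * (cis (2 * pi * (y \<bullet> t)) * of_real (q c y)) \<partial>lborel)
        = h s * of_real (c ^ DIM('a) * gauss (c *\<^sub>R (t - s)))" .
    qed
    \<comment> \<open>The substitution \<open>s = t - (1 / c) *\<^sub>R u\<close> cancels
      \<open>c ^ DIM('a)\<close> and leaves \<open>c\<close> in the argument of \<open>h\<close>
      alone.\<close>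
    also have "\<dots> = \<bar>- (1 / c)\<bar> ^ DIM('a) *\<^sub>R (\<integral>u. h (t + (- (1 / c)) *\<^sub>R u) *
        of_real (c ^ DIM('a) * gauss (c *\<^sub>R (t - (t + (- (1 / c)) *\<^sub>R u)))) \<partial>lborel)"
      by (rule lborel_scale) (use that in auto)
    also have "\<dots> = (\<integral>u. \<bar>- (1 / c)\<bar> ^ DIM('a) *\<^sub>R (h (t + (- (1 / c)) *\<^sub>R u) *
        of_real (c ^ DIM('a) * gauss (c *\<^sub>R (t - (t + (- (1 / c)) *\<^sub>R u))))) \<partial>lborel)"
      by simp
    also have "\<dots> = (\<integral>u. h (t - (1 / c) *\<^sub>R u) * of_real (gauss u) \<partial>lborel)"
      using that by (intro Bochner_Integration.integral_cong refl)
        (simp add: scaleR_conv_of_real power_divide)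
    finally show ?thesis .
  qed
  have "(\<lambda>n. \<integral>y. ?F y * cis (2 * pi * (y \<bullet> t)) * of_real (q (real (Suc n)) y) \<partial>lborel)
    \<longlonglongrightarrow> (\<integral>y. ?F y * cis (2 * pi * (y \<bullet> t)) \<partial>lborel)"
  proof (rule integral_dominated_convergence[where w="\<lambda>y. norm (?F y)"])
    show "AE y in lborel. (\<lambda>n. ?F y * cis (2 * pi * (y \<bullet> t)) * complex_of_real (q (real (Suc n)) y))
      \<longlonglongrightarrow> ?F y * cis (2 * pi * (y \<bullet> t))"
    proof (rule AE_I2)
      fix y :: 'a
      have "(\<lambda>n. 2 * pi * inverse (real (Suc n))) \<longlonglongrightarrow> 2 * pi * 0"
        by (intro tendsto_intros LIMSEQ_inverse_real_of_nat)
      then have "(\<lambda>n. 2 * pi / real (Suc n)) \<longlonglongrightarrow> 0" by (simp add: divide_inverse)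
      then have "(\<lambda>n. q (real (Suc n)) y) \<longlonglongrightarrow> exp (- 0\<^sup>2 * (norm y)\<^sup>2 / 2)"
        unfolding q_eq by (intro tendsto_intros) simp_all
      then have "(\<lambda>n. ?F y * cis (2 * pi * (y \<bullet> t)) * complex_of_real (q (real (Suc n)) y))
        \<longlonglongrightarrow> ?F y * cis (2 * pi * (y \<bullet> t)) * of_real 1"
        by (intro tendsto_intros) simp
      then show "(\<lambda>n. ?F y * cis (2 * pi * (y \<bullet> t)) * complex_of_real (q (real (Suc n)) y))
        \<longlonglongrightarrow> ?F y * cis (2 * pi * (y \<bullet> t))" by simp
    qed
    show "AE y in lborel. norm (?F y * cis (2 * pi * (y \<bullet> t)) * complex_of_real (q (real (Suc n)) y)) \<le> norm (?F y)" for n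
      by (auto simp: norm_mult q_eq intro!: AE_I2 mult_left_le)
  qed (use F in auto)
  moreover have "(\<lambda>n. \<integral>u. h (t - (1 / real (Suc n)) *\<^sub>R u) * of_real (gauss u) \<partial>lborel)
    \<longlonglongrightarrow> (\<integral>u. h t * of_real (gauss (u::'a)) \<partial>lborel)"
  proof (rule integral_dominated_convergence[where w="\<lambda>u::'a. B * gauss u"])
    show "AE u in lborel. (\<lambda>n. h (t - (1 / real (Suc n)) *\<^sub>R u) * complex_of_real (gauss u))
      \<longlonglongrightarrow> h t * of_real (gauss u)"
    proof (rule AE_I2, intro tendsto_intros)
      fix u :: 'a
      have "(\<lambda>n. t - (1 / real (Suc n)) *\<^sub>R u) \<longlonglongrightarrow> t - 0 *\<^sub>R u"
        using LIMSEQ_inverse_real_of_nat by (intro tendsto_intros) (simp add: inverse_eq_divide)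
      then show "(\<lambda>n. h (t - (1 / real (Suc n)) *\<^sub>R u)) \<longlonglongrightarrow> h t"
        using c by (intro continuous_on_tendsto_compose[OF c]) auto
    qed
    have "gauss u \<ge> 0" for u :: 'a by (simp add: gauss_eq)
    then show "AE u in lborel. norm (h (t - (1 / real (Suc n)) *\<^sub>R u) * complex_of_real (gauss u)) \<le> B * gauss u" for n
      by (auto simp: norm_mult intro!: AE_I2 mult_mono bd order_trans[OF norm_ge_zero bd])
  qed (use gauss_integrable in auto)
  ultimately have "(\<integral>y. ?F y * cis (2 * pi * (y \<bullet> t)) \<partial>lborel) = (\<integral>u. h t * of_real (gauss (u::'a)) \<partial>lborel)"
    unfolding key[OF of_nat_0_less_iff[THEN iffD2, OF zero_less_Suc]] by (rule LIMSEQ_unique)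
  also have "\<dots> = h t" using gauss_integral[where 'a='a] by simp
  finally show ?thesis .
qed

subsection \<open>Decay of the short-time Fourier transform\<close>

lemma cis_measurable [measurable]: "cis \<in> borel_measurable borel"
  by (intro borel_measurable_continuous_onI continuous_intros)

lemma cnj_measurable [measurable]: "cnj \<in> borel_measurable borel"
  by (intro borel_measurable_continuous_onI continuous_intros)

lemma cnj_tf_shift:
  "cnj (tf_shift (x, \<xi>) g t) = cnj (g (t - x)) * cis (- (2 * pi * (\<xi> \<bullet> t)))"
  by (simp add: tf_shift_def cis_conv_exp exp_cnj mult_ac)

lemma stft_lborel:
  assumes [measurable]: "f \<in> borel_measurable borel" "g \<in> borel_measurable borel"
  shows "stft g f (x, \<xi>) = (\<integral>t. f t * cnj (g (t - x)) * cis (- (2 * pi * (\<xi> \<bullet> t))) \<partial>lborel)"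
  unfolding stft_def l2_inner_def cnj_tf_shift mult.assoc
  by (rule integral_completion) measurable

section \<open>Polynomial weights\<close>

definition wt :: "'a::euclidean_space \<Rightarrow> real" where
  "wt x = 1 + (norm x)\<^sup>2"

lemma wt_ge1: "1 \<le> wt x" and wt_pos [simp]: "0 < wt x" and wt_nonneg [simp]: "0 \<le> wt x"
  by (auto simp: wt_def add_pos_nonneg)

lemma wt_minus [simp]: "wt (- x) = wt x"
  by (simp add: wt_def)

text \<open>A Peetre-type inequality, from \<open>(norm (x + y))\<^sup>2 \<le> 2 * ((norm x)\<^sup>2
  + (norm y)\<^sup>2)\<close>. It converts decay in \<open>t\<close> and in \<open>t - x\<close>
  into decay in \<open>x\<close>.\<close>

lemma wt_add_le: "wt (x + y) \<le> 2 * (wt x * wt y)"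
proof -
  have "(norm (x + y))\<^sup>2 \<le> (norm x + norm y)\<^sup>2"
    by (intro power_mono norm_triangle_ineq) simp
  also have "\<dots> \<le> 2 * ((norm x)\<^sup>2 + (norm y)\<^sup>2)"
    using zero_le_power2[of "norm x - norm y"] by (simp add: power2_eq_square algebra_simps)
  finally have "(norm (x + y))\<^sup>2 \<le> 2 * ((norm x)\<^sup>2 + (norm y)\<^sup>2)" .
  moreover have "0 \<le> (norm x)\<^sup>2 * (norm y)\<^sup>2" by simp
  moreover have "2 * (wt x * wt y) = 2 + 2 * ((norm x)\<^sup>2 + (norm y)\<^sup>2) + 2 * ((norm x)\<^sup>2 * (norm y)\<^sup>2)"
    by (simp add: wt_def algebra_simps)
  ultimately show ?thesis unfolding wt_def[of "x + y"] by linarith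
qed

lemma wt_measurable [measurable]: "wt \<in> borel_measurable borel"
  unfolding wt_def by measurable

text \<open>Each of the \<open>DIM('a)\<close> factors \<open>1 + (x \<bullet> b)\<^sup>2\<close> is
  at most \<open>wt x\<close>, so the product of the integrable one-dimensional functions
  \<open>1 / (1 + x\<^sup>2)\<close> is a majorant.\<close>

lemma integrable_inverse_wt:
  assumes "n \<ge> DIM('a::euclidean_space)"
  shows "integrable lborel (\<lambda>x::'a. 1 / wt x ^ n)"
proof (rule Bochner_Integration.integrable_bound)
  have "integrable lborel (\<lambda>x::real. 1 / (1 + x\<^sup>2))"
    using integrable_inverse_1_plus_square by (simp add: set_integrable_def inverse_eq_divide)
  then show "integrable lborel (\<lambda>x::'a. \<Prod>b\<in>Basis. 1 / (1 + (x \<bullet> b)\<^sup>2))"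
    by (intro lborel_prod_Basis(1)[where f="\<lambda>_ x. 1 / (1 + x\<^sup>2)"])
  show "AE x in lborel. norm (1 / wt x ^ n) \<le> norm (\<Prod>b\<in>Basis. 1 / (1 + ((x::'a) \<bullet> b)\<^sup>2))"
  proof (rule AE_I2)
    fix x :: 'a
    have "(\<Prod>b\<in>Basis. 1 + (x \<bullet> b)\<^sup>2) \<le> (\<Prod>b\<in>(Basis::'a set). wt x)"
    proof (rule prod_mono)
      fix b :: 'a assume "b \<in> Basis"
      then have "(x \<bullet> b)\<^sup>2 \<le> (norm x)\<^sup>2" using Basis_le_norm[of b x] by (simp add: power2_le_iff_abs_le)
      then show "0 \<le> 1 + (x \<bullet> b)\<^sup>2 \<and> 1 + (x \<bullet> b)\<^sup>2 \<le> wt x" by (simp add: wt_def)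
    qed
    also have "\<dots> \<le> wt x ^ n" using assms wt_ge1[of x] by (simp add: power_increasing)
    finally have "(\<Prod>b\<in>Basis. 1 + (x \<bullet> b)\<^sup>2) \<le> wt x ^ n" .
    moreover have "0 < (\<Prod>b\<in>Basis. 1 + (x \<bullet> b)\<^sup>2)" by (intro prod_pos) (simp add: add_pos_nonneg)
    ultimately show "norm (1 / wt x ^ n) \<le> norm (\<Prod>b\<in>Basis. 1 / (1 + (x \<bullet> b)\<^sup>2))"
      by (simp add: prod_dividef frac_le)
  qed
qed measurable

section \<open>Schwartz functions\<close>

lemma dderiv_append: "dderiv (vs @ ws) f = dderiv vs (dderiv ws f)"
  by (induction vs) auto

lemma schwartz_frechet_derivative:
  assumes "schwartz g" "v \<in> Basis"
  shows "schwartz (\<lambda>x. frechet_derivative g (at x) v)"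
proof -
  have e: "(\<lambda>x. frechet_derivative g (at x) v) = dderiv [v] g" by simp
  show ?thesis
    unfolding e schwartz_def dderiv_append[symmetric]
    using assms unfolding schwartz_def by auto
qed

lemma schwartz_has_derivative:
  assumes "schwartz g"
  shows "(g has_derivative frechet_derivative g (at x)) (at x)"
  using assms unfolding schwartz_def frechet_derivative_works[symmetric]
  by (metis dderiv.simps(1) empty_set empty_subsetI)

lemma schwartz_continuous:
  assumes "schwartz g" shows "continuous_on S g"
  using schwartz_has_derivative[OF assms] has_derivative_continuous continuous_at_imp_continuous_on
  by blast

lemma schwartz_measurable:
  assumes "schwartz g" shows "g \<in> borel_measurable borel"
  using schwartz_continuous[OF assms] by (rule borel_measurable_continuous_onI)

text \<open>The inequality \<open>wt x ^ n \<le> 2 ^ n * (1 + norm x ^ (2 * n))\<close> merges the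
  seminorms of exponents \<open>0\<close> and \<open>2 * n\<close> into one weighted bound. The sign
  of \<open>B\<close> is recorded for later products of such bounds.\<close>

lemma schwartz_decay:
  fixes g :: "'a::euclidean_space \<Rightarrow> complex"
  assumes "schwartz g"
  obtains B where "B \<ge> 0" "\<And>x. norm (g x) \<le> B / wt x ^ n"
proof -
  have b: "bounded (range (\<lambda>x. norm x ^ k * norm (g x)))" for k
    using assms unfolding schwartz_def by (metis dderiv.simps(1) empty_set empty_subsetI)
  obtain B0 where B0: "\<And>x. norm (g x) \<le> B0" using b[of 0] by (auto simp: bounded_iff)
  obtain B1 where B1: "\<And>x. norm x ^ (2 * n) * norm (g x) \<le> B1"
    using b[of "2 * n"] by (auto simp: bounded_iff)
  have "norm (g x) \<le> (2 ^ n * (B0 + B1)) / wt x ^ n" for x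
  proof -
    have "wt x ^ n \<le> (2 * max 1 ((norm x)\<^sup>2)) ^ n"
      by (intro power_mono) (auto simp: wt_def max_def)
    also have "\<dots> \<le> 2 ^ n * (1 + norm x ^ (2 * n))"
      by (auto simp: power_mult_distrib max_def power_mult[symmetric])
    finally have "wt x ^ n * norm (g x) \<le> 2 ^ n * (1 + norm x ^ (2 * n)) * norm (g x)"
      by (rule mult_right_mono) simp
    also have "\<dots> = 2 ^ n * (norm (g x) + norm x ^ (2 * n) * norm (g x))" by (simp add: algebra_simps)
    also have "\<dots> \<le> 2 ^ n * (B0 + B1)" by (intro mult_left_mono add_mono B0 B1) auto
    finally show ?thesis by (simp add: le_divide_eq mult.commute)
  qed
  moreover have "0 \<le> 2 ^ n * (B0 + B1)"
    using order_trans[OF norm_ge_zero B0[of 0]] order_trans[OF _ B1[of 0]] by simp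
  ultimately show ?thesis using that by blast
qed

text \<open>By translation invariance every difference quotient of \<open>F\<close> along
  \<open>j\<close> has integral zero, and dominated convergence passes to the derivative. This is
  the integration by parts behind the decay in frequency.\<close>

lemma integral_directional_derivative_eq_0:
  fixes F :: "'a::euclidean_space \<Rightarrow> complex"
  assumes d: "\<And>t. (F has_derivative F' t) (at t)"
    and j: "norm j = 1" and F: "integrable lborel F"
    and b: "\<And>t. norm (F' t j) \<le> C / wt t ^ DIM('a)"
  shows "(\<integral>t. F' t j \<partial>lborel) = 0"
proof -
  have cF: "continuous_on UNIV F"
    by (intro continuous_at_imp_continuous_on ballI has_derivative_continuous[OF d])
  have [measurable]: "F \<in> borel_measurable borel" using F by auto
  define s where "s n = 1 / real (Suc n)" for n
  have s0: "s n > 0" "s n \<le> 1" for n by (auto simp: s_def)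
  have s: "s \<longlonglongrightarrow> 0" unfolding s_def using LIMSEQ_inverse_real_of_nat by (simp add: inverse_eq_divide)
  define Q where "Q n t = (F (t + s n *\<^sub>R j) - F t) /\<^sub>R s n" for n t
  have [measurable]: "Q n \<in> borel_measurable borel" for n unfolding Q_def by measurable
  have k: "((\<lambda>r. F (t + r *\<^sub>R j)) has_vector_derivative F' (t + r *\<^sub>R j) j) (at r within S)" for t r S
  proof -
    have "((\<lambda>r. F (t + r *\<^sub>R j)) has_derivative (\<lambda>u. F' (t + r *\<^sub>R j) (u *\<^sub>R j))) (at r within S)"
      by (rule has_derivative_compose[OF _ d]) (auto intro!: derivative_eq_intros)
    then show ?thesis
      unfolding has_vector_derivative_def
      by (rule has_derivative_eq_rhs) (use has_derivative_linear[OF d] in \<open>simp add: fun_eq_iff linear_cmul\<close>)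
  qed
  have lim: "(\<lambda>n. Q n t) \<longlonglongrightarrow> F' t j" for t
  proof -
    have "((\<lambda>r. (F (t + r *\<^sub>R j) - F t) /\<^sub>R r) \<longlongrightarrow> F' t j) (at 0)"
    proof (rule LIM_zero_cancel, rule tendsto_norm_zero_cancel)
      have "((\<lambda>r. norm (F (t + r *\<^sub>R j) - F t - r *\<^sub>R F' t j) / norm r) \<longlongrightarrow> 0) (at 0)"
        using k[of t 0 UNIV] by (simp add: has_vector_derivative_def has_derivative_at)
      then show "((\<lambda>r. norm ((F (t + r *\<^sub>R j) - F t) /\<^sub>R r - F' t j)) \<longlongrightarrow> 0) (at 0)"
      proof (rule Lim_transform_eventually)
        have "norm (w - r *\<^sub>R v) / norm r = norm (w /\<^sub>R r - v)" if "r \<noteq> 0" for r and w v :: complex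
        proof -
          have "w /\<^sub>R r - v = (w - r *\<^sub>R v) /\<^sub>R r" using that by (simp add: scaleR_diff_right)
          then show ?thesis by (simp add: divide_inverse mult.commute)
        qed
        then show "\<forall>\<^sub>F r in at 0. norm (F (t + r *\<^sub>R j) - F t - r *\<^sub>R F' t j) / norm r
            = norm ((F (t + r *\<^sub>R j) - F t) /\<^sub>R r - F' t j)"
          by (simp add: eventually_at_filter)
      qed
    qed
    moreover have "\<forall>i. s i \<in> UNIV - {0}" using s0(1) by (auto simp: less_imp_neq[symmetric])
    ultimately show ?thesis
      using s unfolding tendsto_at_iff_sequentially comp_def Q_def by blast
  qed
  have [measurable]: "(\<lambda>t. F' t j) \<in> borel_measurable borel"
    by (rule borel_measurable_LIMSEQ_metric[OF _ lim]) measurable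
  have C: "C \<ge> 0" using order_trans[OF norm_ge_zero b[of 0]] by (simp add: wt_def)
  \<comment> \<open>The quotient is an average of derivatives at points
    \<open>t + r *\<^sub>R j\<close> with \<open>r\<close> in [0, 1]. There
    \<open>wt (r *\<^sub>R j) \<le> 2\<close>, so \<open>wt_add_le\<close> gives
    \<open>wt t \<le> 4 * wt (t + r *\<^sub>R j)\<close>; the resulting majorant is independent of
    \<open>n\<close>.\<close>
  have Qb: "norm (Q n t) \<le> 4 ^ DIM('a) * C * (1 / wt t ^ DIM('a))" for n t
  proof -
    have "norm (F' (t + r *\<^sub>R j) j) \<le> 4 ^ DIM('a) * C * (1 / wt t ^ DIM('a))" if "0 \<le> r" "r \<le> 1" for r
    proof -
      have "wt t = wt ((t + r *\<^sub>R j) + - (r *\<^sub>R j))" by simp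
      also have "\<dots> \<le> 2 * (wt (t + r *\<^sub>R j) * wt (r *\<^sub>R j))" using wt_add_le[of "t + r *\<^sub>R j" "- (r *\<^sub>R j)"] by simp
      also have "\<dots> \<le> 2 * (wt (t + r *\<^sub>R j) * 2)"
        using that j by (intro mult_left_mono) (auto simp: wt_def power_le_one)
      finally have "wt t ^ DIM('a) \<le> (4 * wt (t + r *\<^sub>R j)) ^ DIM('a)" by (intro power_mono) auto
      then have "1 / wt (t + r *\<^sub>R j) ^ DIM('a) \<le> 4 ^ DIM('a) * (1 / wt t ^ DIM('a))"
        by (simp add: field_simps power_mult_distrib)
      then have "C * (1 / wt (t + r *\<^sub>R j) ^ DIM('a)) \<le> C * (4 ^ DIM('a) * (1 / wt t ^ DIM('a)))"
        using C by (rule mult_left_mono)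
      then show ?thesis using b[of "t + r *\<^sub>R j"] by (simp add: mult_ac)
    qed
    then have "norm (F (t + s n *\<^sub>R j) - F (t + 0 *\<^sub>R j)) \<le> 4 ^ DIM('a) * C * (1 / wt t ^ DIM('a)) * norm (s n - 0)"
    proof (intro differentiable_bound[where S="{0..1}" and f="\<lambda>r. F (t + r *\<^sub>R j)"
          and f'="\<lambda>r u. u *\<^sub>R F' (t + r *\<^sub>R j) j"])
      show "((\<lambda>r. F (t + r *\<^sub>R j)) has_derivative (\<lambda>u. u *\<^sub>R F' (t + r *\<^sub>R j) j)) (at r within {0..1})" for r
        using k by (simp add: has_vector_derivative_def)
    next
      fix r :: real assume "r \<in> {0..1}"
      then have "norm (u *\<^sub>R F' (t + r *\<^sub>R j) j) \<le> 4 ^ DIM('a) * C * (1 / wt t ^ DIM('a)) * norm u" for u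
        using \<open>\<And>r. 0 \<le> r \<Longrightarrow> r \<le> 1 \<Longrightarrow> norm (F' (t + r *\<^sub>R j) j) \<le> _\<close>[of r]
          mult_left_mono[of "norm (F' (t + r *\<^sub>R j) j)" "4 ^ DIM('a) * C * (1 / wt t ^ DIM('a))" "norm u"]
        by (simp add: mult.commute)
      then show "onorm (\<lambda>u. u *\<^sub>R F' (t + r *\<^sub>R j) j) \<le> 4 ^ DIM('a) * C * (1 / wt t ^ DIM('a))"
        by (rule onorm_le)
    qed (use s0 in \<open>auto intro: less_imp_le\<close>)
    moreover have "norm (Q n t) = norm (F (t + s n *\<^sub>R j) - F t) / s n"
      using s0(1)[of n] by (simp add: Q_def divide_inverse mult.commute)
    ultimately show ?thesis using s0(1)[of n] by (simp add: pos_divide_le_eq)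
  qed
  have "(\<integral>t. Q n t \<partial>lborel) = 0" for n
    unfolding Q_def using F lborel_translation[of F "s n *\<^sub>R j"]
    by simp
  moreover have "(\<lambda>n. \<integral>t. Q n t \<partial>lborel) \<longlonglongrightarrow> (\<integral>t. F' t j \<partial>lborel)"
    by (rule integral_dominated_convergence[where w="\<lambda>t. 4 ^ DIM('a) * C * (1 / wt t ^ DIM('a))"])
      (auto intro!: AE_I2 Qb lim integrable_mult_right integrable_inverse_wt simp del: times_divide_eq_right)
  ultimately show ?thesis by (simp add: LIMSEQ_const_iff)
qed

text \<open>Since \<open>x = t - (t - x)\<close>, the weight \<open>wt x ^ n\<close> splits into
  powers of \<open>wt t\<close> and \<open>wt (t - x)\<close>, which the decay of \<open>a\<close>
  and of \<open>b\<close> absorbs. The estimate is uniform in \<xi> because the exponential has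
  modulus 1.\<close>

lemma stft_decay_translation:
  fixes a b :: "'a::euclidean_space \<Rightarrow> complex"
  assumes a: "schwartz a" and b: "schwartz b"
  shows "integrable lborel (\<lambda>t. a t * cnj (b (t - x)) * cis (- (2 * pi * (\<xi> \<bullet> t))))"
    and "\<exists>C. \<forall>x \<xi>. wt x ^ n * norm (stft b a (x, \<xi>)) \<le> C"
proof -
  have [measurable]: "a \<in> borel_measurable borel" "b \<in> borel_measurable borel"
    using a b by (auto intro: schwartz_measurable)
  let ?h = "\<lambda>x \<xi> t. a t * cnj (b (t - x)) * cis (- (2 * pi * (\<xi> \<bullet> t)))"
  have key: "\<exists>C. \<forall>x \<xi> t. wt x ^ n * norm (?h x \<xi> t) \<le> C * (1 / wt t ^ DIM('a))" for n
  proof -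
    \<comment> \<open>Order \<open>n\<close> pays for the weight in \<open>x\<close>; the additional
      \<open>DIM('a)\<close> keeps the bound integrable in \<open>t\<close>.\<close>
    obtain A where A: "A \<ge> 0" "\<And>x. norm (a x) \<le> A / wt x ^ (n + DIM('a))"
      using schwartz_decay[OF a, of "n + DIM('a)"] by blast
    obtain B where B: "B \<ge> 0" "\<And>x. norm (b x) \<le> B / wt x ^ n" using schwartz_decay[OF b, of n] by blast
    have "wt x ^ n * norm (?h x \<xi> t) \<le> 2 ^ n * A * B * (1 / wt t ^ DIM('a))" for x \<xi> t
    proof -
      have "wt x ^ n \<le> (2 * (wt t * wt (t - x))) ^ n"
        using wt_add_le[of t "- (t - x)"] unfolding wt_minus by (intro power_mono) simp_all
      then have "wt x ^ n * norm (?h x \<xi> t) \<le> (2 * (wt t * wt (t - x))) ^ n * (norm (a t) * norm (b (t - x)))"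
        by (simp add: norm_mult mult_right_mono)
      also have "\<dots> \<le> (2 * (wt t * wt (t - x))) ^ n * (A / wt t ^ (n + DIM('a)) * (B / wt (t - x) ^ n))"
        by (intro mult_left_mono mult_mono A B) (auto intro!: A B divide_nonneg_nonneg)
      also have "\<dots> = 2 ^ n * A * B * (1 / wt t ^ DIM('a))"
        using wt_pos[of t] wt_pos[of "t - x"] by (simp add: field_simps power_mult_distrib power_add del: wt_pos)
      finally show ?thesis .
    qed
    then show ?thesis by blast
  qed
  obtain C0 where C0: "\<And>x \<xi> t. norm (?h x \<xi> t) \<le> C0 * (1 / wt t ^ DIM('a))" using key[of 0] by auto
  have I: "integrable lborel (?h x \<xi>)" for x \<xi>
    by (rule Bochner_Integration.integrable_bound[of lborel "\<lambda>t. C0 * (1 / wt t ^ DIM('a))"])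
      (auto intro!: AE_I2 order_trans[OF C0] integrable_mult_right integrable_inverse_wt
        order_trans[OF _ abs_ge_self] simp del: norm_mult times_divide_eq_right)
  then show "integrable lborel (?h x \<xi>)" .
  obtain C where C: "\<And>x \<xi> t. wt x ^ n * norm (?h x \<xi> t) \<le> C * (1 / wt t ^ DIM('a))" using key[of n] by auto
  have "wt x ^ n * norm (stft b a (x, \<xi>)) \<le> (\<integral>t. C * (1 / wt (t::'a) ^ DIM('a)) \<partial>lborel)" for x \<xi>
  proof -
    have "wt x ^ n * norm (stft b a (x, \<xi>)) \<le> wt x ^ n * (\<integral>t. norm (?h x \<xi> t) \<partial>lborel)"
      by (subst stft_lborel) (auto intro!: mult_left_mono integral_norm_bound)
    also have "\<dots> = (\<integral>t. wt x ^ n * norm (?h x \<xi> t) \<partial>lborel)" by simp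
    also have "\<dots> \<le> (\<integral>t. C * (1 / wt (t::'a) ^ DIM('a)) \<partial>lborel)"
      by (rule integral_mono[OF _ _ C])
        (auto intro!: integrable_norm integrable_mult_right integrable_inverse_wt I
          simp del: norm_mult times_divide_eq_right)
    finally show ?thesis .
  qed
  then show "\<exists>C. \<forall>x \<xi>. wt x ^ n * norm (stft b a (x, \<xi>)) \<le> C" by blast
qed

text \<open>The derivative along \<open>j\<close> of \<open>a t * cnj (b (t - x)) * cis (- (2 * pi *
  (\<xi> \<bullet> t)))\<close> has integral zero. Its exponential factor contributes the frequency
  \<open>\<xi> \<bullet> j\<close>, the other two factors contribute transforms of differentiated
  functions.\<close>

lemma stft_partial_derivative:
  fixes a b :: "'a::euclidean_space \<Rightarrow> complex"
  assumes a: "schwartz a" and b: "schwartz b" and j: "j \<in> Basis"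
  shows "2 * pi * \<i> * of_real (\<xi> \<bullet> j) * stft b a (x, \<xi>) =
    stft b (\<lambda>t. frechet_derivative a (at t) j) (x, \<xi>) + stft (\<lambda>t. frechet_derivative b (at t) j) a (x, \<xi>)"
proof -
  define a' where "a' t = frechet_derivative a (at t) j" for t
  define b' where "b' t = frechet_derivative b (at t) j" for t
  have sa: "schwartz a'" and sb: "schwartz b'"
    using schwartz_frechet_derivative[OF a j] schwartz_frechet_derivative[OF b j] by (simp_all add: a'_def[abs_def] b'_def[abs_def])
  note m = a[THEN schwartz_measurable] b[THEN schwartz_measurable] sa[THEN schwartz_measurable] sb[THEN schwartz_measurable]
  let ?e = "\<lambda>t. cis (- (2 * pi * (\<xi> \<bullet> t)))"
  let ?F = "\<lambda>t. a t * cnj (b (t - x)) * ?e t"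
  let ?F' = "\<lambda>t h. (a t * cnj (b (t - x))) * (- (2 * pi * (\<xi> \<bullet> h))) *\<^sub>R (\<i> * ?e t) +
     (a t * cnj (frechet_derivative b (at (t - x)) h) + frechet_derivative a (at t) h * cnj (b (t - x))) * ?e t"
  have dF: "(?F has_derivative ?F' t) (at t)" for t
  proof -
    have "((\<lambda>t. b (t - x)) has_derivative frechet_derivative b (at (t - x))) (at t)"
      by (rule has_derivative_compose[OF _ schwartz_has_derivative[OF b], of "\<lambda>t. t - x" "\<lambda>h. h" t UNIV])
        (auto intro!: derivative_eq_intros)
    then have 1: "((\<lambda>t. a t * cnj (b (t - x))) has_derivative
      (\<lambda>h. a t * cnj (frechet_derivative b (at (t - x)) h) + frechet_derivative a (at t) h * cnj (b (t - x)))) (at t)"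
      by (intro has_derivative_mult schwartz_has_derivative a has_derivative_cnj)
    have 2: "(?e has_derivative (\<lambda>h. (- (2 * pi * (\<xi> \<bullet> h))) *\<^sub>R (\<i> * ?e t))) (at t)"
      by (rule has_derivative_cis) (auto intro!: derivative_eq_intros)
    show ?thesis by (rule has_derivative_mult[OF 1 2])
  qed
  have e: "?F' t j = (- (2 * pi * (\<xi> \<bullet> j)) * \<i>) * ?F t + a t * cnj (b' (t - x)) * ?e t + a' t * cnj (b (t - x)) * ?e t" for t
    by (simp add: a'_def b'_def scaleR_conv_of_real algebra_simps)
  note I = stft_decay_translation(1)[OF a b, of x \<xi>] stft_decay_translation(1)[OF a sb, of x \<xi>]
    stft_decay_translation(1)[OF sa b, of x \<xi>]
  have bd: "\<exists>C\<ge>0. \<forall>t. norm (u t * cnj (v (t - x)) * ?e t) \<le> C / wt t ^ DIM('a)"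
    if uv: "schwartz u" "schwartz v" for u v :: "'a \<Rightarrow> complex"
  proof -
    obtain A where A: "A \<ge> 0" "\<And>x. norm (u x) \<le> A / wt x ^ DIM('a)" using schwartz_decay[OF uv(1), of "DIM('a)"] by blast
    obtain B where B: "B \<ge> 0" "\<And>x. norm (v x) \<le> B / wt x ^ 0" using schwartz_decay[OF uv(2), of 0] by blast
    have "norm (u t * cnj (v (t - x)) * ?e t) \<le> A / wt t ^ DIM('a) * B" for t
    proof -
      have "norm (u t) * norm (v (t - x)) \<le> A / wt t ^ DIM('a) * B"
        using B(2)[of "t - x"] A(1) by (intro mult_mono A(2)) simp_all
      then show ?thesis by (simp add: norm_mult)
    qed
    then show ?thesis using A(1) B(1) by (intro exI[of _ "A * B"]) (auto simp: mult_ac)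
  qed
  obtain C1 where C1: "\<And>t. norm (?F t) \<le> C1 / wt t ^ DIM('a)" using bd[OF a b] by blast
  obtain C2 where C2: "\<And>t. norm (a t * cnj (b' (t - x)) * ?e t) \<le> C2 / wt t ^ DIM('a)" using bd[OF a sb] by blast
  obtain C3 where C3: "\<And>t. norm (a' t * cnj (b (t - x)) * ?e t) \<le> C3 / wt t ^ DIM('a)" using bd[OF sa b] by blast
  let ?K = "norm (- (2 * pi * (\<xi> \<bullet> j)) * \<i>)"
  have "norm (?F' t j) \<le> (?K * C1 + C2 + C3) / wt t ^ DIM('a)" for t
  proof -
    have "norm (?F' t j) \<le> ?K * norm (?F t) + norm (a t * cnj (b' (t - x)) * ?e t) + norm (a' t * cnj (b (t - x)) * ?e t)"
      unfolding e by (rule order_trans[OF norm_triangle_ineq add_mono[OF order_trans[OF norm_triangle_ineq] order_refl]])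
        (simp add: norm_mult)
    also have "\<dots> \<le> ?K * (C1 / wt t ^ DIM('a)) + C2 / wt t ^ DIM('a) + C3 / wt t ^ DIM('a)"
      by (intro add_mono mult_left_mono C1 C2 C3) auto
    finally show ?thesis by (simp add: add_divide_distrib)
  qed
  from integral_directional_derivative_eq_0[OF dF _ I(1) this] have "(\<integral>t. ?F' t j \<partial>lborel) = 0" using j by simp
  then have "(- (2 * pi * (\<xi> \<bullet> j)) * \<i>) * (\<integral>t. ?F t \<partial>lborel) + (\<integral>t. a t * cnj (b' (t - x)) * ?e t \<partial>lborel)
    + (\<integral>t. a' t * cnj (b (t - x)) * ?e t \<partial>lborel) = 0"
    unfolding e using I by simp
  then show ?thesis
    unfolding a'_def[abs_def,symmetric] b'_def[abs_def,symmetric]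
    by (simp add: stft_lborel m algebra_simps)
qed

text \<open>Each factor \<open>\<bar>\<xi> \<bullet> j\<bar>\<close> is traded for a derivative of
  the signal or of the window. Derivatives are again Schwartz functions, so the induction runs over
  all pairs \<open>a\<close>, \<open>b\<close> at once; the factor \<open>2 * pi\<close>, being at
  least 1, is dropped.\<close>

lemma stft_decay_component:
  fixes a b :: "'a::euclidean_space \<Rightarrow> complex"
  assumes j: "j \<in> Basis"
  shows "schwartz a \<Longrightarrow> schwartz b \<Longrightarrow>
    \<exists>C. \<forall>x \<xi>. wt x ^ n * (\<bar>\<xi> \<bullet> j\<bar> ^ k * norm (stft b a (x, \<xi>))) \<le> C"
proof (induction k arbitrary: a b)
  case 0
  then show ?case using stft_decay_translation(2)[of a b n] by simp
next
  case (Suc k)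
  let ?a = "\<lambda>t. frechet_derivative a (at t) j" and ?b = "\<lambda>t. frechet_derivative b (at t) j"
  obtain C1 where C1: "\<And>x \<xi>. wt x ^ n * (\<bar>\<xi> \<bullet> j\<bar> ^ k * norm (stft b ?a (x, \<xi>))) \<le> C1"
    using Suc.IH[OF schwartz_frechet_derivative[OF Suc.prems(1) j] Suc.prems(2)] by blast
  obtain C2 where C2: "\<And>x \<xi>. wt x ^ n * (\<bar>\<xi> \<bullet> j\<bar> ^ k * norm (stft ?b a (x, \<xi>))) \<le> C2"
    using Suc.IH[OF Suc.prems(1) schwartz_frechet_derivative[OF Suc.prems(2) j]] by blast
  have "wt x ^ n * (\<bar>\<xi> \<bullet> j\<bar> ^ Suc k * norm (stft b a (x, \<xi>))) \<le> C1 + C2" for x \<xi>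
  proof -
    have "\<bar>\<xi> \<bullet> j\<bar> * norm (stft b a (x, \<xi>)) \<le> 2 * pi * (\<bar>\<xi> \<bullet> j\<bar> * norm (stft b a (x, \<xi>)))"
      using pi_gt3 by (intro mult_right_mono[of 1 "2 * pi", simplified]) auto
    also have "\<dots> = norm (2 * pi * \<i> * of_real (\<xi> \<bullet> j) * stft b a (x, \<xi>))"
      by (simp add: norm_mult)
    also have "\<dots> \<le> norm (stft b ?a (x, \<xi>)) + norm (stft ?b a (x, \<xi>))"
      unfolding stft_partial_derivative[OF Suc.prems j] by (rule norm_triangle_ineq)
    finally have "wt x ^ n * \<bar>\<xi> \<bullet> j\<bar> ^ k * (\<bar>\<xi> \<bullet> j\<bar> * norm (stft b a (x, \<xi>)))
      \<le> wt x ^ n * \<bar>\<xi> \<bullet> j\<bar> ^ k * (norm (stft b ?a (x, \<xi>)) + norm (stft ?b a (x, \<xi>)))"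
      by (rule mult_left_mono) simp
    then show ?thesis using C1[of x \<xi>] C2[of x \<xi>] by (simp add: algebra_simps)
  qed
  then show ?case by blast
qed

text \<open>The bounds in single frequency coordinates are assembled into one weight. The product
  form in \<open>x\<close> and \<xi> allows integration over each variable separately.\<close>

lemma stft_decay:
  fixes a b :: "'a::euclidean_space \<Rightarrow> complex"
  assumes a: "schwartz a" and b: "schwartz b"
  obtains C where "\<And>x \<xi>. norm (stft b a (x, \<xi>)) \<le> C * (1 / wt x ^ n * (1 / wt \<xi> ^ n))"
proof -
  obtain C0 where C0: "\<And>x \<xi>. wt x ^ n * norm (stft b a (x, \<xi>)) \<le> C0"
    using stft_decay_translation(2)[OF a b] by blast
  have "\<forall>j\<in>Basis. \<exists>C. \<forall>x \<xi>. wt x ^ n * (\<bar>\<xi> \<bullet> j\<bar> ^ (2 * n) * norm (stft b a (x, \<xi>))) \<le> C"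
    using stft_decay_component[OF _ a b] by blast
  then obtain C where C: "\<And>j x \<xi>. j \<in> Basis \<Longrightarrow> wt x ^ n * (\<bar>\<xi> \<bullet> j\<bar> ^ (2 * n) * norm (stft b a (x, \<xi>))) \<le> C j"
    by metis
  let ?d = "real (Suc DIM('a))"
  have w: "wt \<xi> ^ n \<le> ?d ^ n * (1 + (\<Sum>j\<in>Basis. \<bar>\<xi> \<bullet> j\<bar> ^ (2 * n)))" for \<xi> :: 'a
  proof -
    \<comment> \<open>Including \<open>1\<close> in the set makes \<open>M\<close> dominate the
      constant term of \<open>wt\<close> too, so \<open>wt \<xi> \<le> ?d * M\<close>. As
      \<open>M\<close> is attained at \<open>1\<close> or at a single coordinate,
      \<open>M ^ n\<close> is bounded by the sum of all the powers.\<close>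
    define M where "M = Max (insert 1 ((\<lambda>j. (\<xi> \<bullet> j)\<^sup>2) ` Basis))"
    have M: "1 \<le> M" "\<And>j. j \<in> Basis \<Longrightarrow> (\<xi> \<bullet> j)\<^sup>2 \<le> M"
      and M_in: "M \<in> insert 1 ((\<lambda>j. (\<xi> \<bullet> j)\<^sup>2) ` Basis)"
      using Max_ge[of "insert 1 ((\<lambda>j. (\<xi> \<bullet> j)\<^sup>2) ` Basis)"] Max_in[of "insert 1 ((\<lambda>j. (\<xi> \<bullet> j)\<^sup>2) ` Basis)"]
      unfolding M_def by (simp_all del: Max_insert)
    have "wt \<xi> \<le> 1 + (\<Sum>j\<in>(Basis::'a set). M)"
      unfolding wt_def norm_power2_eq_sum by (intro add_mono sum_mono M) auto
    also have "\<dots> \<le> ?d * M" using M(1) by (simp add: algebra_simps)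
    finally have "wt \<xi> ^ n \<le> (?d * M) ^ n" by (intro power_mono) auto
    also have "\<dots> = ?d ^ n * M ^ n" by (rule power_mult_distrib)
    also have "M ^ n \<le> 1 + (\<Sum>j\<in>Basis. \<bar>\<xi> \<bullet> j\<bar> ^ (2 * n))"
    proof (cases "M = 1")
      case True then show ?thesis by (simp add: sum_nonneg)
    next
      case False
      then obtain j where j: "j \<in> Basis" "M = (\<xi> \<bullet> j)\<^sup>2" using M_in by auto
      then have "M ^ n = \<bar>\<xi> \<bullet> j\<bar> ^ (2 * n)" by (simp add: power_mult)
      also have "\<dots> \<le> (\<Sum>j\<in>Basis. \<bar>\<xi> \<bullet> j\<bar> ^ (2 * n))"
        using j(1) by (intro member_le_sum) auto
      finally show ?thesis by simp
    qed
    finally show ?thesis by simp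
  qed
  have "norm (stft b a (x, \<xi>)) \<le> ?d ^ n * (C0 + (\<Sum>j\<in>Basis. C j)) * (1 / wt x ^ n * (1 / wt \<xi> ^ n))" for x \<xi>
  proof -
    let ?V = "norm (stft b a (x, \<xi>))"
    have "wt \<xi> ^ n * (wt x ^ n * ?V) \<le> ?d ^ n * (1 + (\<Sum>j\<in>Basis. \<bar>\<xi> \<bullet> j\<bar> ^ (2 * n))) * (wt x ^ n * ?V)"
      by (rule mult_right_mono[OF w]) simp
    also have "\<dots> = ?d ^ n * (wt x ^ n * ?V + (\<Sum>j\<in>Basis. wt x ^ n * (\<bar>\<xi> \<bullet> j\<bar> ^ (2 * n) * ?V)))"
      by (simp add: distrib_left distrib_right sum_distrib_right sum_distrib_left mult_ac)
    also have "\<dots> \<le> ?d ^ n * (C0 + (\<Sum>j\<in>Basis. C j))"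
      by (intro mult_left_mono add_mono sum_mono C C0) auto
    finally show ?thesis by (simp add: field_simps)
  qed
  then show ?thesis using that by blast
qed

subsection \<open>Square-integrable functions\<close>

text \<open>The Borel counterpart of \<open>in_L2\<close>: joint measurability on product spaces
  then follows by composition.\<close>

definition sq_int :: "('a::euclidean_space \<Rightarrow> complex) \<Rightarrow> bool" where
  "sq_int f \<longleftrightarrow> f \<in> borel_measurable borel \<and> integrable lborel (\<lambda>t. (cmod (f t))\<^sup>2)"

abbreviation energy :: "('a::euclidean_space \<Rightarrow> complex) \<Rightarrow> real" where
  "energy f \<equiv> \<integral>t. (cmod (f t))\<^sup>2 \<partial>lborel"

abbreviation ip :: "('a::euclidean_space \<Rightarrow> complex) \<Rightarrow> ('a \<Rightarrow> complex) \<Rightarrow> complex" where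
  "ip f h \<equiv> \<integral>t. f t * cnj (h t) \<partial>lborel"

lemma sq_int_measurable: "sq_int f \<Longrightarrow> f \<in> borel_measurable borel"
  by (simp add: sq_int_def)

text \<open>The arithmetic-geometric mean inequality stands in for Cauchy-Schwarz. It avoids square
  roots and gives the same constant 1 for unit vectors.\<close>

lemma sq_int_mult:
  assumes "sq_int f" "sq_int g"
  shows "integrable lborel (\<lambda>t. f t * cnj (g t))"
    and "(\<integral>t. cmod (f t) * cmod (g t) \<partial>lborel) \<le> (energy f + energy g) / 2"
proof -
  have [measurable]: "f \<in> borel_measurable borel" "g \<in> borel_measurable borel"
    using assms by (auto simp: sq_int_def)
  have b: "cmod (f t) * cmod (g t) \<le> ((cmod (f t))\<^sup>2 + (cmod (g t))\<^sup>2) / 2" for t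
    using sum_squares_bound[of "cmod (f t)" "cmod (g t)"] by simp
  have i: "integrable lborel (\<lambda>t. ((cmod (f t))\<^sup>2 + (cmod (g t))\<^sup>2) / 2)"
    using assms by (auto simp: sq_int_def)
  have fg: "integrable lborel (\<lambda>t. cmod (f t) * cmod (g t))"
  proof (rule Bochner_Integration.integrable_bound[OF i])
    show "AE t in lborel. norm (cmod (f t) * cmod (g t)) \<le> norm (((cmod (f t))\<^sup>2 + (cmod (g t))\<^sup>2) / 2)"
      using b by (intro AE_I2) (simp only: real_norm_def abs_of_nonneg[OF mult_nonneg_nonneg[OF norm_ge_zero norm_ge_zero]] order_trans[OF _ abs_ge_self])
  qed measurable
  show "integrable lborel (\<lambda>t. f t * cnj (g t))"
    by (rule Bochner_Integration.integrable_bound[OF fg]) (auto simp: norm_mult)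
  have "(\<integral>t. cmod (f t) * cmod (g t) \<partial>lborel) \<le> (\<integral>t. ((cmod (f t))\<^sup>2 + (cmod (g t))\<^sup>2) / 2 \<partial>lborel)"
    by (rule integral_mono[OF fg i b])
  also have "\<dots> = (energy f + energy g) / 2" using assms by (simp add: sq_int_def)
  finally show "(\<integral>t. cmod (f t) * cmod (g t) \<partial>lborel) \<le> (energy f + energy g) / 2" .
qed

lemma norm_ip_le:
  assumes "sq_int f" "sq_int g"
  shows "cmod (ip f g) \<le> (energy f + energy g) / 2"
  using integral_norm_bound[of lborel "\<lambda>t. f t * cnj (g t)"] sq_int_mult(2)[OF assms]
  by (simp add: norm_mult)

lemma ip_commute: "ip g f = cnj (ip f g)"
proof -
  have "cnj (ip f g) = (\<integral>t. cnj (f t * cnj (g t)) \<partial>lborel)" by (rule Bochner_Integration.integral_cnj[symmetric])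
  then show ?thesis by (simp add: mult.commute)
qed

text \<open>With \<open>?s\<close> the orthogonal projection of \<open>h\<close> onto the span of
  the family, the pairings of \<open>h\<close> with \<open>?s\<close>, of \<open>?s\<close> with
  \<open>h\<close> and of \<open>?s\<close> with itself all equal \<open>S\<close>. Hence the energy
  of \<open>h - ?s\<close> is \<open>energy h - S\<close>, and it is nonnegative.\<close>

lemma bessel:
  fixes n :: nat
  assumes e: "\<And>i. i < n \<Longrightarrow> sq_int (e i)"
    and o: "\<And>i j. i < n \<Longrightarrow> j < n \<Longrightarrow> ip (e i) (e j) = (if i = j then 1 else 0)"
    and h: "sq_int h"
  shows "(\<Sum>i<n. (cmod (ip h (e i)))\<^sup>2) \<le> energy h"
proof -
  define c where "c i = ip h (e i)" for i
  define S where "S = (\<Sum>i<n. (cmod (c i))\<^sup>2)"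
  let ?s = "\<lambda>t. \<Sum>i<n. c i * e i t"
  note I = sq_int_mult(1)
  have hh: "integrable lborel (\<lambda>t. h t * cnj (h t))" using I[OF h h] .
  have hs: "integrable lborel (\<lambda>t. h t * cnj (?s t))"
    and hsv: "ip h ?s = of_real S"
  proof -
    have eq: "h t * cnj (?s t) = (\<Sum>i<n. cnj (c i) * (h t * cnj (e i t)))" for t
      by (simp add: sum_distrib_left mult_ac)
    show "integrable lborel (\<lambda>t. h t * cnj (?s t))"
      unfolding eq by (intro Bochner_Integration.integrable_sum integrable_mult_right I h e) auto
    have "ip h ?s = (\<Sum>i<n. cnj (c i) * ip h (e i))"
      unfolding eq by (subst Bochner_Integration.integral_sum) (auto intro!: integrable_mult_right I h e)
    also have "\<dots> = of_real S"
      by (simp only: c_def[symmetric] S_def of_real_sum complex_norm_square mult.commute)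
    finally show "ip h ?s = of_real S" .
  qed
  have sh: "integrable lborel (\<lambda>t. ?s t * cnj (h t))" and shv: "ip ?s h = of_real S"
  proof -
    have "integrable lborel (\<lambda>t. cnj (h t * cnj (?s t)))" using hs by (simp only: complex_integrable_cnj)
    then show "integrable lborel (\<lambda>t. ?s t * cnj (h t))" by (simp add: mult.commute)
    show "ip ?s h = of_real S" by (subst ip_commute) (simp only: hsv complex_cnj_complex_of_real)
  qed
  have ss: "integrable lborel (\<lambda>t. ?s t * cnj (?s t))" and ssv: "ip ?s ?s = of_real S"
  proof -
    have eq: "?s t * cnj (?s t) = (\<Sum>i<n. \<Sum>j<n. c i * cnj (c j) * (e i t * cnj (e j t)))" for t
      by (simp add: sum_product mult_ac)
    show "integrable lborel (\<lambda>t. ?s t * cnj (?s t))"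
      unfolding eq by (intro Bochner_Integration.integrable_sum integrable_mult_right I e) auto
    have "ip ?s ?s = (\<Sum>i<n. \<integral>t. (\<Sum>j<n. c i * cnj (c j) * (e i t * cnj (e j t))) \<partial>lborel)"
      unfolding eq by (rule Bochner_Integration.integral_sum)
        (auto intro!: Bochner_Integration.integrable_sum integrable_mult_right I e)
    also have "\<dots> = (\<Sum>i<n. \<Sum>j<n. c i * cnj (c j) * ip (e i) (e j))"
      by (intro sum.cong refl, subst Bochner_Integration.integral_sum)
        (auto intro!: integrable_mult_right I e)
    also have "\<dots> = (\<Sum>i<n. \<Sum>j<n. if i = j then c i * cnj (c j) else 0)"
      by (intro sum.cong refl) (simp add: o)
    also have "\<dots> = (\<Sum>i<n. c i * cnj (c i))"
      by (intro sum.cong refl, subst sum.delta') auto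
    also have "\<dots> = of_real S" by (simp only: S_def of_real_sum complex_norm_square)
    finally show "ip ?s ?s = of_real S" .
  qed
  have "(\<integral>t. (h t - ?s t) * cnj (h t - ?s t) \<partial>lborel)
    = (\<integral>t. h t * cnj (h t) - h t * cnj (?s t) - (?s t * cnj (h t) - ?s t * cnj (?s t)) \<partial>lborel)"
  proof -
    have "(x - y) * cnj (x - y) = x * cnj x - x * cnj y - (y * cnj x - y * cnj y)" for x y
      by (simp add: algebra_simps)
    then show ?thesis by (simp only:)
  qed
  also have "\<dots> = ip h h - ip h ?s - (ip ?s h - ip ?s ?s)"
    using hh hs sh ss by (simp del: cnj_sum)
  also have "\<dots> = ip h h - of_real S" by (simp only: hsv shv ssv diff_self diff_zero)
  finally have "(\<integral>t. complex_of_real ((cmod (h t - ?s t))\<^sup>2) \<partial>lborel) = of_real (energy h) - of_real S"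
    by (simp only: complex_norm_square[symmetric] integral_complex_of_real)
  then have "(\<integral>t. (cmod (h t - ?s t))\<^sup>2 \<partial>lborel) = energy h - S"
    by (simp only: integral_complex_of_real of_real_diff[symmetric] of_real_eq_iff)
  moreover have "0 \<le> (\<integral>t. (cmod (h t - ?s t))\<^sup>2 \<partial>lborel)" by simp
  ultimately show ?thesis by (simp add: S_def c_def)
qed

subsection \<open>The reproducing formula\<close>

lemma tf_shift_cis: "tf_shift (x, \<xi>) g t = cis (2 * pi * (\<xi> \<bullet> t)) * g (t - x)"
  by (simp add: tf_shift_def cis_conv_exp mult_ac)

lemma tf_shift_eq: "tf_shift z g t = cis (2 * pi * (snd z \<bullet> t)) * g (t - fst z)"
  by (cases z) (simp add: tf_shift_cis)

lemma fst_borel [measurable]: "fst \<in> borel_measurable (borel :: ('a::second_countable_topology \<times> 'b::second_countable_topology) measure)"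
  and snd_borel [measurable]: "snd \<in> borel_measurable (borel :: ('a \<times> 'b) measure)"
  by (auto simp: borel_prod[symmetric])

lemma tf_shift_measurable [measurable]:
  assumes [measurable]: "g \<in> borel_measurable borel"
  shows "(\<lambda>(z, t). tf_shift z g t) \<in> borel_measurable (borel \<Otimes>\<^sub>M borel)"
    and "tf_shift z g \<in> borel_measurable borel"
proof -
  show "(\<lambda>(z, t). tf_shift z g t) \<in> borel_measurable (borel \<Otimes>\<^sub>M borel)" unfolding tf_shift_eq by measurable
  show "tf_shift z g \<in> borel_measurable borel" unfolding tf_shift_eq[abs_def] by measurable
qed

lemma sq_int_tf_shift:
  fixes g :: "'a::euclidean_space \<Rightarrow> complex"
  assumes "sq_int g"
  shows "sq_int (tf_shift z g)" "energy (tf_shift z g) = energy g"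
proof -
  have [measurable]: "g \<in> borel_measurable borel" using assms by (simp add: sq_int_def)
  have *: "(cmod (tf_shift z g t))\<^sup>2 = (cmod (g (t + - fst z)))\<^sup>2" for t
    by (cases z) (simp add: tf_shift_cis norm_mult)
  note tr = lborel_translation[of "\<lambda>t. (cmod (g t))\<^sup>2" "- fst z"]
  show "energy (tf_shift z g) = energy g" unfolding * by (rule tr) measurable
  show "sq_int (tf_shift z g)"
    using assms tr(2) unfolding sq_int_def * by simp
qed

lemma stft_eq_ip:
  assumes [measurable]: "f \<in> borel_measurable borel" "g \<in> borel_measurable borel"
  shows "stft g f z = ip f (tf_shift z g)"
  unfolding stft_def l2_inner_def by (rule integral_completion) measurable

lemma stft_measurable:
  assumes [measurable]: "f \<in> borel_measurable borel" "g \<in> borel_measurable borel"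
  shows "stft g f \<in> borel_measurable borel"
proof -
  have "(\<lambda>(z, t). f t * cnj (tf_shift z g t)) \<in> borel_measurable (borel \<Otimes>\<^sub>M lborel)"
    by (simp cong: measurable_cong_sets sets_pair_measure_cong) 
  then have "(\<lambda>z. ip f (tf_shift z g)) \<in> borel_measurable borel"
    by (rule sigma_finite_measure.borel_measurable_lebesgue_integral[OF sigma_finite_lborel])
  then show ?thesis by (subst (asm) stft_eq_ip[symmetric]) auto
qed

section \<open>Integrability of the short-time Fourier transform for Schwartz windows\<close>

lemma schwartz_sq_int:
  fixes g :: "'a::euclidean_space \<Rightarrow> complex"
  assumes "schwartz g" shows "sq_int g"
proof -
  have [measurable]: "g \<in> borel_measurable borel" using assms by (rule schwartz_measurable)
  obtain B where B: "\<And>x. norm (g x) \<le> B / wt x ^ DIM('a)" using schwartz_decay[OF assms] by metis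
  have "integrable lborel (\<lambda>t. (cmod (g t))\<^sup>2)"
  proof (rule Bochner_Integration.integrable_bound)
    show "integrable lborel (\<lambda>x::'a. B\<^sup>2 * (1 / wt x ^ (2 * DIM('a))))"
      by (intro integrable_mult_right integrable_inverse_wt) simp
    have "(cmod (g t))\<^sup>2 \<le> B\<^sup>2 * (1 / wt t ^ (2 * DIM('a)))" for t
      using power_mono[OF B norm_ge_zero, of t 2] by (simp add: power_divide power_mult[symmetric] mult.commute)
    then show "AE t in lborel. norm ((cmod (g t))\<^sup>2) \<le> norm (B\<^sup>2 * (1 / wt t ^ (2 * DIM('a))))" by simp
  qed measurable
  then show ?thesis by (simp add: sq_int_def)
qed

text \<open>This prices the factor \<open>norm w\<close> in the final constant: one additional power
  of the weight in position and in frequency.\<close>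

lemma norm_prod_le_wt: "norm z \<le> wt (fst z) * wt (snd z)"
proof -
  have "norm z \<le> 1 + (norm z)\<^sup>2" using sum_squares_bound[of "norm z" 1] zero_le_power2[of "norm z"] by (simp; linarith)
  also have "\<dots> = 1 + (norm (fst z))\<^sup>2 + (norm (snd z))\<^sup>2" by (simp add: norm_prod_def)
  also have "\<dots> \<le> wt (fst z) * wt (snd z)" by (simp add: wt_def algebra_simps)
  finally show ?thesis .
qed

text \<open>The first integral is the constant of the theorem. Decay of order
  \<open>DIM('a) + 1\<close> in both variables is used: one power absorbs \<open>norm w\<close>, the
  remaining \<open>DIM('a)\<close> are integrable.\<close>

lemma stft_integrable:
  fixes a b :: "'a::euclidean_space \<Rightarrow> complex"
  assumes a: "schwartz a" and b: "schwartz b"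
  shows "integrable lborel (\<lambda>w. norm w * cmod (stft b a w))" and "integrable lborel (stft b a)"
proof -
  let ?d = "DIM('a)"
  note m = stft_measurable[OF a[THEN schwartz_measurable] b[THEN schwartz_measurable], measurable]
  have I: "integrable lborel (\<lambda>w::'a \<times> 'a. 1 / wt (fst w) ^ ?d * (1 / wt (snd w) ^ ?d))"
  proof -
    have "integrable (lborel \<Otimes>\<^sub>M lborel) (\<lambda>(x::'a, y::'a). 1 / wt x ^ ?d * (1 / wt y ^ ?d))"
      by (rule Fubini_product_bound(1)[OF _ _ integrable_inverse_wt integrable_inverse_wt]) auto
    then show ?thesis by (simp add: lborel_prod case_prod_unfold)
  qed
  obtain C where C: "\<And>x \<xi>. norm (stft b a (x, \<xi>)) \<le> C * (1 / wt x ^ Suc ?d * (1 / wt \<xi> ^ Suc ?d))"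
    using stft_decay[OF a b] by metis
  have C0: "C \<ge> 0" using order_trans[OF norm_ge_zero C[of 0 0]] by (simp add: wt_def)
  have 1: "wt (fst w) * wt (snd w) * cmod (stft b a w) \<le> C * (1 / wt (fst w) ^ ?d * (1 / wt (snd w) ^ ?d))" for w
  proof -
    have "wt (fst w) * wt (snd w) * cmod (stft b a w)
      \<le> wt (fst w) * wt (snd w) * (C * (1 / wt (fst w) ^ Suc ?d * (1 / wt (snd w) ^ Suc ?d)))"
      using C[of "fst w" "snd w"] by (intro mult_left_mono) simp_all
    also have "\<dots> = C * (1 / wt (fst w) ^ ?d * (1 / wt (snd w) ^ ?d))"
      using wt_pos[of "fst w"] wt_pos[of "snd w"] by (simp add: field_simps del: wt_pos)
    finally show ?thesis .
  qed
  have J: "integrable lborel (\<lambda>w::'a \<times> 'a. C * (1 / wt (fst w) ^ ?d * (1 / wt (snd w) ^ ?d)))"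
    using I by (rule integrable_mult_right)
  have pos: "0 \<le> C * (1 / wt (fst w) ^ ?d * (1 / wt (snd w) ^ ?d))" for w :: "'a \<times> 'a" using C0 by simp
  show "integrable lborel (\<lambda>w. norm w * cmod (stft b a w))"
  proof (rule Bochner_Integration.integrable_bound[OF J])
    have "norm w * cmod (stft b a w) \<le> C * (1 / wt (fst w) ^ ?d * (1 / wt (snd w) ^ ?d))" for w
      using mult_right_mono[OF norm_prod_le_wt[of w], of "cmod (stft b a w)"] 1[of w] by simp
    then show "AE w in lborel. norm (norm w * cmod (stft b a w)) \<le> norm (C * (1 / wt (fst w) ^ ?d * (1 / wt (snd w) ^ ?d)))"
      using pos by (intro AE_I2) (simp only: real_norm_def abs_of_nonneg mult_nonneg_nonneg norm_ge_zero)
  qed measurable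
  show "integrable lborel (stft b a)"
  proof (rule Bochner_Integration.integrable_bound[OF J])
    have "1 \<le> wt (fst w) * wt (snd w)" for w :: "'a \<times> 'a"
      using mult_mono[of 1 "wt (fst w)" 1 "wt (snd w)"] wt_ge1 by auto
    then have "cmod (stft b a w) \<le> C * (1 / wt (fst w) ^ ?d * (1 / wt (snd w) ^ ?d))" for w
      using mult_right_mono[of 1 "wt (fst w) * wt (snd w)" "cmod (stft b a w)"] 1[of w] by simp
    then show "AE w in lborel. norm (stft b a w) \<le> norm (C * (1 / wt (fst w) ^ ?d * (1 / wt (snd w) ^ ?d)))"
      using pos by (intro AE_I2) (simp only: real_norm_def abs_of_nonneg)
  qed measurable
qed

section \<open>Reconstruction from the short-time Fourier transform\<close>

lemma schwartz_bounded:
  assumes "schwartz g" obtains B where "B \<ge> 0" "\<And>x. norm (g x) \<le> B"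
  using schwartz_decay[OF assms, of 0] by auto

text \<open>At fixed position \<open>y\<close> the integral over frequency is Fourier inversion for
  \<open>s \<mapsto> a s * cnj (b (s - y))\<close> at the point \<open>t\<close>, with value
  \<open>a t * (cmod (b (t - y)))\<^sup>2\<close> after multiplication by \<open>b (t - y)\<close>.
  Integration over \<open>y\<close> produces the energy of \<open>b\<close>. The identity holds at
  every \<open>t\<close>.\<close>

lemma stft_reproducing:
  fixes a b :: "'a::euclidean_space \<Rightarrow> complex"
  assumes a: "schwartz a" and b: "schwartz b"
  shows "(\<integral>w. stft b a w * tf_shift w b t \<partial>lborel) = a t * of_real (energy b)"
proof -
  note [measurable] = a[THEN schwartz_measurable] b[THEN schwartz_measurable]
  note [measurable] = stft_measurable[of a b]
  obtain A where A: "A \<ge> 0" "\<And>x. norm (a x) \<le> A" using schwartz_bounded[OF a] by blast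
  obtain B where B: "B \<ge> 0" "\<And>x. norm (b x) \<le> B" using schwartz_bounded[OF b] by blast
  have I: "integrable lborel (\<lambda>w. stft b a w * tf_shift w b t)"
  proof (rule Bochner_Integration.integrable_bound)
    show "integrable lborel (\<lambda>w. of_real B * stft b a w)" using stft_integrable(2)[OF a b] by (rule integrable_mult_right)
    show "AE w in lborel. norm (stft b a w * tf_shift w b t) \<le> norm (of_real B * stft b a w)"
      using B by (auto simp: norm_mult tf_shift_cis mult.commute mult_right_mono)
    show "(\<lambda>w. stft b a w * tf_shift w b t) \<in> borel_measurable lborel"
      unfolding tf_shift_eq by measurable
  qed
  have inner: "(\<integral>\<eta>. stft b a (y, \<eta>) * tf_shift (y, \<eta>) b t \<partial>lborel) = a t * of_real ((cmod (b (t - y)))\<^sup>2)" for y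
  proof -
    let ?h = "\<lambda>s. a s * cnj (b (s - y))"
    have eq: "stft b a (y, \<eta>) = (\<integral>s. ?h s * cis (- (2 * pi * (\<eta> \<bullet> s))) \<partial>lborel)" for \<eta>
      by (rule stft_lborel) measurable
    have "(\<integral>\<eta>. (\<integral>s. ?h s * cis (- (2 * pi * (\<eta> \<bullet> s))) \<partial>lborel) * cis (2 * pi * (\<eta> \<bullet> t)) \<partial>lborel) = ?h t"
    proof (rule fourier_inversion)
      show "integrable lborel ?h" using stft_decay_translation(1)[OF a b, of y 0] by simp
      show "continuous_on UNIV ?h"
        by (intro continuous_intros schwartz_continuous[OF a] continuous_on_compose2[OF schwartz_continuous[OF b, of UNIV]]) auto
      show "norm (?h s) \<le> A * B" for s
        using A B by (simp add: norm_mult mult_mono)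
      \<comment> \<open>Inversion is applied for every \<open>y\<close>, while joint integrability
        would give integrability in frequency only for almost every \<open>y\<close>; hence the
        pointwise decay estimate.\<close>
      obtain C where C: "\<And>x \<xi>. norm (stft b a (x, \<xi>)) \<le> C * (1 / wt x ^ DIM('a) * (1 / wt \<xi> ^ DIM('a)))"
        using stft_decay[OF a b] by metis
      have "integrable lborel (\<lambda>\<eta>. stft b a (y, \<eta>))"
      proof (rule Bochner_Integration.integrable_bound)
        show "integrable lborel (\<lambda>\<xi>. C * (1 / wt y ^ DIM('a) * (1 / wt (\<xi>::'a) ^ DIM('a))))"
          by (intro integrable_mult_right integrable_inverse_wt order_refl)
        show "AE \<xi> in lborel. norm (stft b a (y, \<xi>)) \<le> norm (C * (1 / wt y ^ DIM('a) * (1 / wt \<xi> ^ DIM('a))))"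
          by (intro AE_I2 order_trans[OF C]) (simp only: real_norm_def abs_ge_self)
      qed measurable
      then show "integrable lborel (\<lambda>\<eta>. \<integral>s. ?h s * cis (- (2 * pi * (\<eta> \<bullet> s))) \<partial>lborel)"
        by (simp only: eq)
    qed
    then have "(\<integral>\<eta>. b (t - y) * (stft b a (y, \<eta>) * cis (2 * pi * (\<eta> \<bullet> t))) \<partial>lborel) = b (t - y) * ?h t"
      by (simp only: eq integral_mult_right_zero)
    then show ?thesis by (simp only: tf_shift_cis complex_norm_square mult_ac)
  qed
  have "(\<integral>w. stft b a w * tf_shift w b t \<partial>lborel)
    = (\<integral>y. (\<integral>\<eta>. stft b a (y, \<eta>) * tf_shift (y, \<eta>) b t \<partial>lborel) \<partial>lborel)"
    using lborel_pair.integral_fst[of "\<lambda>y \<eta>. stft b a (y, \<eta>) * tf_shift (y, \<eta>) b t"] I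
    by (simp add: lborel_prod case_prod_unfold)
  also have "\<dots> = a t * of_real (\<integral>y. (cmod (b (t - y)))\<^sup>2 \<partial>lborel)"
    unfolding inner by (simp only: integral_mult_right_zero integral_complex_of_real)
  also have "(\<integral>y. (cmod (b (t - y)))\<^sup>2 \<partial>lborel) = energy b"
    using lborel_scale(1)[of "\<lambda>t. (cmod (b t))\<^sup>2" "-1" t] by simp
  finally show ?thesis .
qed

text \<open>Time-frequency shifts compose up to a phase, the cocycle of the Heisenberg group. The
  phase depends on \<open>w\<close> and \<open>z\<close> but not on \<open>t\<close>, so it leaves
  every inner product in \<open>t\<close> as a scalar.\<close>

lemma tf_shift_tf_shift:
  "tf_shift z (tf_shift w g) t = cis (- (2 * pi * (snd w \<bullet> fst z))) * tf_shift (z + w) g t"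
proof -
  obtain x \<xi> y \<eta> where zw: "z = (x, \<xi>)" "w = (y, \<eta>)" by (cases z, cases w)
  have "cis (2 * pi * (\<xi> \<bullet> t)) * cis (2 * pi * (\<eta> \<bullet> (t - x)))
    = cis (- (2 * pi * (\<eta> \<bullet> x))) * cis (2 * pi * ((\<xi> + \<eta>) \<bullet> t))"
    by (simp add: cis_mult inner_diff_right inner_add_left algebra_simps)
  then show ?thesis by (simp add: zw tf_shift_cis mult.assoc[symmetric] diff_diff_eq)
qed

text \<open>The shift by \<open>z\<close> is applied to the reproducing formula for
  \<open>a\<close>, and the result is paired with \<open>f\<close>. Fubini is justified by the bound
  \<open>cmod (stft b a w) * ((1 + energy f) / 2)\<close> for the inner integral, since shifted
  windows keep energy 1.\<close>

lemma cnj_stft_expand: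
  fixes a b f :: "'a::euclidean_space \<Rightarrow> complex"
  assumes a: "schwartz a" and b: "schwartz b" and b1: "energy b = 1" and f: "sq_int f"
  shows "cnj (stft a f z) = (\<integral>w. stft b a w * (cis (- (2 * pi * (snd w \<bullet> fst z))) * cnj (stft b f (z + w))) \<partial>lborel)"
proof -
  note [measurable] = a[THEN schwartz_measurable] b[THEN schwartz_measurable] sq_int_measurable[OF f]
  note [measurable] = stft_measurable[of a b]
  let ?c = "\<lambda>w. cis (- (2 * pi * (snd w \<bullet> fst z)))"
  let ?F = "\<lambda>w t. stft b a w * ?c w * (tf_shift (z + w) b t * cnj (f t))"
  have point: "tf_shift z a t = (\<integral>w. stft b a w * ?c w * tf_shift (z + w) b t \<partial>lborel)" for t
  proof -
    have "(\<integral>w. stft b a w * ?c w * tf_shift (z + w) b t \<partial>lborel) = (\<integral>w. stft b a w * tf_shift z (tf_shift w b) t \<partial>lborel)"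
      by (simp add: tf_shift_tf_shift mult.assoc)
    also have "\<dots> = (\<integral>w. cis (2 * pi * (snd z \<bullet> t)) * (stft b a w * tf_shift w b (t - fst z)) \<partial>lborel)"
      by (cases z) (simp add: tf_shift_cis mult_ac)
    also have "\<dots> = tf_shift z a t"
      by (cases z) (simp add: stft_reproducing[OF a b] b1 tf_shift_cis)
    finally show ?thesis ..
  qed
  have sb: "sq_int (tf_shift (z + w) b)" "energy (tf_shift (z + w) b) = 1" for w
    using sq_int_tf_shift[OF schwartz_sq_int[OF b]] b1 by auto
  have Fm: "(\<lambda>(w, t). ?F w t) \<in> borel_measurable (borel \<Otimes>\<^sub>M borel)"
  proof -
    have "(\<lambda>(w, t). tf_shift (z + w) b t) \<in> borel_measurable (borel \<Otimes>\<^sub>M borel)"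
      using measurable_compose[of "\<lambda>(w, t). (z + w, t)" "borel \<Otimes>\<^sub>M borel" "borel \<Otimes>\<^sub>M borel" "\<lambda>(z, t). tf_shift z b t" borel]
      by (simp add: case_prod_beta)
    then show ?thesis unfolding case_prod_beta by measurable
  qed
  have fub: "(\<integral>w. \<integral>t. ?F w t \<partial>lborel \<partial>lborel) = (\<integral>t. \<integral>w. ?F w t \<partial>lborel \<partial>lborel)"
  proof (rule Fubini_bound(2)[OF Fm])
    show "integrable lborel (?F w)" for w
      by (intro integrable_mult_right sq_int_mult(1) sb f)
    show "(\<integral>t. norm (?F w t) \<partial>lborel) \<le> cmod (stft b a w) * ((1 + energy f) / 2)" for w
      using mult_left_mono[OF sq_int_mult(2)[OF sb(1)[of w] f], of "cmod (stft b a w)"]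
      by (simp add: norm_mult sb(2) mult.assoc)
    show "integrable lborel (\<lambda>w. cmod (stft b a w) * ((1 + energy f) / 2))"
      using stft_integrable(2)[OF a b] by (intro integrable_mult_left integrable_norm)
  qed
  have "cnj (stft a f z) = ip (tf_shift z a) f"
    by (subst stft_eq_ip) (auto simp: ip_commute[of "tf_shift z a" f])
  also have "\<dots> = (\<integral>t. \<integral>w. ?F w t \<partial>lborel \<partial>lborel)"
    unfolding point by (simp add: mult.assoc flip: integral_mult_left_zero)
  also have "\<dots> = (\<integral>w. \<integral>t. ?F w t \<partial>lborel \<partial>lborel)" using fub ..
  also have "\<dots> = (\<integral>w. stft b a w * ?c w * ip (tf_shift (z + w) b) f \<partial>lborel)" by simp
  also have "\<dots> = (\<integral>w. stft b a w * ?c w * cnj (stft b f (z + w)) \<partial>lborel)"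
    by (intro Bochner_Integration.integral_cong refl, subst stft_eq_ip)
      (auto simp: ip_commute[of "tf_shift (z + w) b" f for w])
  finally show ?thesis by (simp add: mult.assoc)
qed

text \<open>The substitution that translates \<open>t\<close> by the position of \<open>w\<close>
  exchanges signal and window. It is the reason why the expansions of \<open>a\<close> in shifts of
  \<open>b\<close> and of \<open>b\<close> in shifts of \<open>a\<close> can be written with the
  same coefficients.\<close>

lemma stft_uminus:
  fixes a b :: "'a::euclidean_space \<Rightarrow> complex"
  assumes [measurable]: "a \<in> borel_measurable borel" "b \<in> borel_measurable borel"
  shows "cnj (stft a b (- w)) = cis (2 * pi * (snd w \<bullet> fst w)) * stft b a w"
proof -
  obtain y \<eta> where w: "w = (y, \<eta>)" by (cases w)
  have "stft a b (- w) = (\<integral>t. b t * cnj (a (t + y)) * cis (2 * pi * (\<eta> \<bullet> t)) \<partial>lborel)"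
    using stft_lborel[of b a "- y" "- \<eta>"] by (simp add: w)
  also have "\<dots> = (\<integral>t. b (t + - y) * cnj (a (t + - y + y)) * cis (2 * pi * (\<eta> \<bullet> (t + - y))) \<partial>lborel)"
    by (rule lborel_translation(1)[symmetric, of "\<lambda>t. b t * cnj (a (t + y)) * cis (2 * pi * (\<eta> \<bullet> t))"]) measurable
  also have "\<dots> = (\<integral>t. cis (- (2 * pi * (\<eta> \<bullet> y))) * cnj (a t * cnj (b (t - y)) * cis (- (2 * pi * (\<eta> \<bullet> t)))) \<partial>lborel)"
  proof (intro Bochner_Integration.integral_cong refl)
    fix t
    have "cis (2 * pi * (\<eta> \<bullet> (t + - y))) = cis (- (2 * pi * (\<eta> \<bullet> y))) * cis (2 * pi * (\<eta> \<bullet> t))"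
      by (simp add: cis_mult inner_diff_right algebra_simps)
    then show "b (t + - y) * cnj (a (t + - y + y)) * cis (2 * pi * (\<eta> \<bullet> (t + - y)))
      = cis (- (2 * pi * (\<eta> \<bullet> y))) * cnj (a t * cnj (b (t - y)) * cis (- (2 * pi * (\<eta> \<bullet> t))))"
      by (simp add: cis_cnj mult_ac)
  qed
  also have "\<dots> = cis (- (2 * pi * (\<eta> \<bullet> y))) * cnj (stft b a w)"
    by (simp only: integral_mult_right_zero Bochner_Integration.integral_cnj stft_lborel w assms)
  finally show ?thesis by (simp add: w cis_cnj)
qed

text \<open>This is the conjugate of the preceding expansion with the roles of \<open>a\<close> and
  \<open>b\<close> exchanged. The reflection of \<open>w\<close> followed by
  \<open>stft_uminus\<close> restores the coefficient \<open>stft b a w\<close>.\<close>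

lemma stft_expand:
  fixes a b e :: "'a::euclidean_space \<Rightarrow> complex"
  assumes a: "schwartz a" and b: "schwartz b" and a1: "energy a = 1" and e: "sq_int e"
  shows "stft b e z = (\<integral>w. stft b a w * (cis (- (2 * pi * (snd w \<bullet> fst (z - w)))) * stft a e (z - w)) \<partial>lborel)"
proof -
  note m = a[THEN schwartz_measurable] b[THEN schwartz_measurable] sq_int_measurable[OF e]
  note [measurable] = m stft_measurable[OF m(1,2)] stft_measurable[OF m(2,1)] stft_measurable[OF m(3,1)]
  let ?f = "\<lambda>w. cnj (stft a b w) * (cis (2 * pi * (snd w \<bullet> fst z)) * stft a e (z + w))"
  have "stft b e z = cnj (cnj (stft b e z))" by simp
  also have "\<dots> = (\<integral>w. ?f w \<partial>lborel)"
    by (subst cnj_stft_expand[OF b a a1 e], subst Bochner_Integration.integral_cnj[symmetric]) (simp add: cis_cnj)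
  also have "\<dots> = (\<integral>w. ?f (- w) \<partial>lborel)"
    using lborel_scale(1)[of ?f "-1" 0] by simp
  also have "\<dots> = (\<integral>w. stft b a w * (cis (- (2 * pi * (snd w \<bullet> fst (z - w)))) * stft a e (z - w)) \<partial>lborel)"
  proof (intro Bochner_Integration.integral_cong refl)
    fix w
    \<comment> \<open>The phase from \<open>stft_uminus\<close> completes the phase at
      \<open>z\<close> to the one at \<open>z - w\<close>, so both expansions lead to the same
      kernel, evaluated at points that differ by \<open>w\<close>.\<close>
    have "cis (2 * pi * (snd w \<bullet> fst w)) * cis (2 * pi * (snd (- w) \<bullet> fst z)) = cis (- (2 * pi * (snd w \<bullet> fst (z - w))))"
      by (simp add: cis_mult inner_diff_right algebra_simps)
    then show "?f (- w) = stft b a w * (cis (- (2 * pi * (snd w \<bullet> fst (z - w)))) * stft a e (z - w))"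
      unfolding stft_uminus[OF m(1,2)] by (simp add: mult_ac)
  qed
  finally show ?thesis .
qed

subsection \<open>Comparison of localization operators\<close>

lemma stft_bound:
  assumes "sq_int f" "sq_int g"
  shows "cmod (stft g f z) \<le> (energy f + energy g) / 2"
  using norm_ip_le[OF assms(1) sq_int_tf_shift(1)[OF assms(2)], of z] assms
  by (simp add: stft_eq_ip sq_int_measurable sq_int_tf_shift(2))

text \<open>The integrals over \<open>z\<close> and \<open>t\<close> are exchanged: \<open>m\<close>
  is integrable in \<open>z\<close>, and the integral over \<open>t\<close> is bounded uniformly in
  \<open>z\<close> by energies. Integrability and measurability are stated as well so that two
  operators can be subtracted under the inner product.\<close>

lemma loc_op_weak:
  fixes g e f :: "'a::euclidean_space \<Rightarrow> complex" and m :: "'a \<times> 'a \<Rightarrow> real"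
  assumes g: "sq_int g" and e: "sq_int e" and f: "sq_int f" and m: "integrable lborel m"
  shows "integrable lborel (\<lambda>t. loc_op g m e t * cnj (f t))"
    and "ip (loc_op g m e) f = (\<integral>z. complex_of_real (m z) * (stft g e z * cnj (stft g f z)) \<partial>lborel)"
    and "loc_op g m e \<in> borel_measurable borel"
proof -
  note ms = sq_int_measurable[OF g] sq_int_measurable[OF e] sq_int_measurable[OF f]
  note [measurable] = ms borel_measurable_integrable[OF m, simplified] stft_measurable[OF ms(2,1)]
  let ?F = "\<lambda>z t. complex_of_real (m z) * stft g e z * (tf_shift z g t * cnj (f t))"
  have lo: "loc_op g m e t = (\<integral>z. complex_of_real (m z) * stft g e z * tf_shift z g t \<partial>lborel)" for t
    unfolding loc_op_def tf_shift_eq by (rule integral_completion) measurable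
  have Fm: "(\<lambda>(z, t). ?F z t) \<in> borel_measurable (borel \<Otimes>\<^sub>M borel)"
    unfolding case_prod_beta tf_shift_eq by measurable
  let ?B = "(energy e + energy g) / 2 * ((energy g + energy f) / 2)"
  note F = Fubini_bound[OF Fm, of "\<lambda>z. \<bar>m z\<bar> * ?B"]
  have F1: "integrable lborel (?F z)" for z
    by (intro integrable_mult_right sq_int_mult(1) sq_int_tf_shift g f)
  have F2: "(\<integral>t. norm (?F z t) \<partial>lborel) \<le> \<bar>m z\<bar> * ?B" for z
  proof -
    have "(\<integral>t. norm (?F z t) \<partial>lborel) = \<bar>m z\<bar> * (cmod (stft g e z) * (\<integral>t. cmod (tf_shift z g t) * cmod (f t) \<partial>lborel))"
      by (simp add: norm_mult mult.assoc)
    also have "\<dots> \<le> \<bar>m z\<bar> * ?B"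
      using sq_int_mult(2)[OF sq_int_tf_shift(1)[OF g, of z] f] stft_bound[OF e g, of z]
      by (intro mult_left_mono mult_mono) (simp_all add: sq_int_tf_shift(2)[OF g])
    finally show ?thesis .
  qed
  have F3: "integrable lborel (\<lambda>z. \<bar>m z\<bar> * ?B)" using m by (intro integrable_mult_left) simp
  note F = F[OF F1 F2 F3]
  have lof: "loc_op g m e t * cnj (f t) = (\<integral>z. ?F z t \<partial>lborel)" for t
    unfolding lo by (simp add: mult.assoc flip: integral_mult_left_zero)
  show "integrable lborel (\<lambda>t. loc_op g m e t * cnj (f t))" unfolding lof by (rule F(4))
  have "ip (loc_op g m e) f = (\<integral>z. \<integral>t. ?F z t \<partial>lborel \<partial>lborel)" unfolding lof F(2) ..
  also have "\<dots> = (\<integral>z. complex_of_real (m z) * stft g e z * ip (tf_shift z g) f \<partial>lborel)" by simp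
  also have "\<dots> = (\<integral>z. complex_of_real (m z) * (stft g e z * cnj (stft g f z)) \<partial>lborel)"
    by (intro Bochner_Integration.integral_cong refl, subst stft_eq_ip[of f])
      (auto simp: ip_commute[of "tf_shift z g" f for z] mult.assoc)
  finally show "ip (loc_op g m e) f = (\<integral>z. complex_of_real (m z) * (stft g e z * cnj (stft g f z)) \<partial>lborel)" .
  have "(\<lambda>(t, z). complex_of_real (m z) * stft g e z * tf_shift z g t) \<in> borel_measurable (borel \<Otimes>\<^sub>M borel)"
    unfolding case_prod_beta tf_shift_eq by measurable
  then have "(\<lambda>(t, z). complex_of_real (m z) * stft g e z * tf_shift z g t) \<in> borel_measurable (borel \<Otimes>\<^sub>M lborel)"
    by (simp cong: measurable_cong_sets sets_pair_measure_cong)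
  then show "loc_op g m e \<in> borel_measurable borel"
    unfolding lo[abs_def] by (rule sigma_finite_measure.borel_measurable_lebesgue_integral[OF sigma_finite_lborel])
qed

text \<open>The kernel \<open>K\<^sub>w(z)\<close> with the phase of the composed shifts included;
  its modulus is free of the phase.\<close>

definition cross :: "('a::euclidean_space \<Rightarrow> complex) \<Rightarrow> ('a \<Rightarrow> complex) \<Rightarrow> ('a \<Rightarrow> complex) \<Rightarrow> ('a \<Rightarrow> complex)
    \<Rightarrow> 'a \<times> 'a \<Rightarrow> 'a \<times> 'a \<Rightarrow> complex" where
  "cross a b e f w z = cis (- (2 * pi * (snd w \<bullet> fst z))) * (stft a e z * cnj (stft b f (z + w)))"

lemma norm_cross: "cmod (cross a b e f w z) = cmod (stft a e z) * cmod (stft b f (z + w))"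
  by (simp add: cross_def norm_mult)

lemma cross_measurable:
  assumes [measurable]: "a \<in> borel_measurable borel" "b \<in> borel_measurable borel"
    "e \<in> borel_measurable borel" "f \<in> borel_measurable borel"
  shows "(\<lambda>(w, z). cross a b e f w z) \<in> borel_measurable (borel \<Otimes>\<^sub>M borel)"
proof -
  note [measurable] = stft_measurable[OF assms(3,1)] stft_measurable[OF assms(4,2)]
  show ?thesis unfolding cross_def case_prod_beta by measurable
qed

text \<open>The kernel is bounded by a constant \<open>B\<close>, so
  \<open>cmod (stft b a w) * B * \<bar>m z\<bar>\<close> is a product majorant for both double
  integrals and all exchanges are legitimate. The inner integrals \<open>G\<close> are named because
  the sum over a family is later taken over them.\<close>

lemma spectrogram_difference:
  fixes a b e f :: "'a::euclidean_space \<Rightarrow> complex" and m :: "'a \<times> 'a \<Rightarrow> real"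
  assumes a: "schwartz a" and b: "schwartz b" and a1: "energy a = 1" and b1: "energy b = 1"
    and e: "sq_int e" and f: "sq_int f" and m: "integrable lborel m"
  defines "G \<equiv> \<lambda>w. \<integral>z. complex_of_real (m z - m (z + w)) * cross a b e f w z \<partial>lborel"
  shows "integrable lborel (\<lambda>w. stft b a w * G w)"
    and "(\<integral>z. complex_of_real (m z) * (stft a e z * cnj (stft a f z)) \<partial>lborel)
       - (\<integral>z. complex_of_real (m z) * (stft b e z * cnj (stft b f z)) \<partial>lborel)
       = (\<integral>w. stft b a w * G w \<partial>lborel)"
proof -
  note ms = a[THEN schwartz_measurable] b[THEN schwartz_measurable] sq_int_measurable[OF e] sq_int_measurable[OF f]
  note [measurable] = ms borel_measurable_integrable[OF m, simplified] stft_measurable[OF ms(1,2)]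
  let ?V = "stft b a" and ?K = "cross a b e f"
  define B where "B = (energy e + energy a) / 2 * ((energy f + energy b) / 2)"
  have KB: "cmod (?K w z) \<le> B" for w z
    unfolding norm_cross B_def
    using stft_bound[OF e schwartz_sq_int[OF a], of z] stft_bound[OF f schwartz_sq_int[OF b], of "z + w"]
    by (intro mult_mono) auto
  have Km: "(\<lambda>(w, z). ?K w z) \<in> borel_measurable (borel \<Otimes>\<^sub>M borel)" by (rule cross_measurable) measurable
  have Kc: "(\<lambda>p. ?K (h p) (k p)) \<in> borel_measurable N" if [measurable]: "h \<in> N \<rightarrow>\<^sub>M borel" "k \<in> N \<rightarrow>\<^sub>M borel" for h k N
    using measurable_compose[OF _ Km, of "\<lambda>p. (h p, k p)" N] by simp
  have Vi: "integrable lborel (\<lambda>w. cmod (?V w) * B)"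
    using stft_integrable(2)[OF a b] by (intro integrable_mult_left integrable_norm)
  have mi: "integrable lborel (\<lambda>z. \<bar>m z\<bar>)" using m by simp
  let ?F1 = "\<lambda>w z. ?V w * (complex_of_real (m z) * ?K w z)"
  let ?F2 = "\<lambda>w z. ?V w * (complex_of_real (m z) * ?K w (z - w))"
  have b1': "norm (?V w * (complex_of_real (m z) * ?K w z')) \<le> cmod (?V w) * B * \<bar>m z\<bar>" for w z z'
    using mult_left_mono[OF KB[of w z'], of "cmod (?V w) * \<bar>m z\<bar>"] by (simp add: norm_mult mult_ac)
  have m1: "(\<lambda>(w, z). ?F1 w z) \<in> borel_measurable (borel \<Otimes>\<^sub>M borel)"
    unfolding case_prod_beta by (intro borel_measurable_times Kc) measurable
  have m2: "(\<lambda>(w, z). ?F2 w z) \<in> borel_measurable (borel \<Otimes>\<^sub>M borel)"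
    unfolding case_prod_beta by (intro borel_measurable_times Kc) measurable
  note F1 = Fubini_product_bound[OF m1 b1' Vi mi]
  note F2 = Fubini_product_bound[OF m2 b1' Vi mi]
  have e1: "(\<integral>z. complex_of_real (m z) * (stft a e z * cnj (stft a f z)) \<partial>lborel) = (\<integral>w. \<integral>z. ?F1 w z \<partial>lborel \<partial>lborel)"
  proof -
    have "complex_of_real (m z) * (stft a e z * cnj (stft a f z)) = (\<integral>w. ?F1 w z \<partial>lborel)" for z
      unfolding cnj_stft_expand[OF a b b1 f, of z] integral_mult_right_zero[symmetric]
      by (intro Bochner_Integration.integral_cong refl) (simp add: cross_def mult_ac)
    then show ?thesis using F1(2) by simp
  qed
  have e2: "(\<integral>z. complex_of_real (m z) * (stft b e z * cnj (stft b f z)) \<partial>lborel) = (\<integral>w. \<integral>z. ?F2 w z \<partial>lborel \<partial>lborel)"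
  proof -
    have "complex_of_real (m z) * (stft b e z * cnj (stft b f z)) = (\<integral>w. ?F2 w z \<partial>lborel)" for z
      unfolding stft_expand[OF a b a1 e, of z] integral_mult_right_zero[symmetric] integral_mult_left_zero[symmetric]
      by (intro Bochner_Integration.integral_cong refl) (simp add: cross_def mult_ac)
    then show ?thesis using F2(2) by simp
  qed
  have mK: "integrable lborel (\<lambda>z. complex_of_real (m (z + v)) * ?K w z)" for v w
  proof (rule Bochner_Integration.integrable_bound)
    show "integrable lborel (\<lambda>z. B * \<bar>m (z + v)\<bar>)"
      using m by (intro integrable_mult_right) (simp add: lborel_translation(2)[of m])
    show "AE z in lborel. norm (complex_of_real (m (z + v)) * ?K w z) \<le> norm (B * \<bar>m (z + v)\<bar>)"
    proof (rule AE_I2)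
      fix z
      have "0 \<le> B" using order_trans[OF norm_ge_zero KB] .
      then show "norm (complex_of_real (m (z + v)) * ?K w z) \<le> norm (B * \<bar>m (z + v)\<bar>)"
        using mult_right_mono[OF KB[of w z], of "\<bar>m (z + v)\<bar>"] by (simp add: norm_mult abs_mult mult.commute)
    qed
    show "(\<lambda>z. complex_of_real (m (z + v)) * ?K w z) \<in> borel_measurable lborel"
      by (intro borel_measurable_times Kc) measurable
  qed
  \<comment> \<open>Translating the variable of the second integral by \<open>w\<close> moves the
    shift from the kernel to the symbol.\<close>
  have G: "?V w * G w = (\<integral>z. ?F1 w z \<partial>lborel) - (\<integral>z. ?F2 w z \<partial>lborel)" for w
  proof -
    have "(\<integral>z. complex_of_real (m z) * ?K w (z - w) \<partial>lborel)
      = (\<integral>z. complex_of_real (m (z + w)) * ?K w (z + w - w) \<partial>lborel)"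
      by (rule lborel_translation(1)[symmetric]) (intro borel_measurable_times Kc; measurable)
    then have "G w = (\<integral>z. complex_of_real (m z) * ?K w z \<partial>lborel) - (\<integral>z. complex_of_real (m z) * ?K w (z - w) \<partial>lborel)"
      using mK[of 0 w] mK[of w w] by (simp add: G_def left_diff_distrib)
    then show ?thesis by (simp add: right_diff_distrib)
  qed
  show "integrable lborel (\<lambda>w. ?V w * G w)"
    unfolding G using F1(3) F2(3) by (rule Bochner_Integration.integrable_diff)
  show "(\<integral>z. complex_of_real (m z) * (stft a e z * cnj (stft a f z)) \<partial>lborel)
       - (\<integral>z. complex_of_real (m z) * (stft b e z * cnj (stft b f z)) \<partial>lborel)
       = (\<integral>w. ?V w * G w \<partial>lborel)"
    unfolding e1 e2 G by (rule Bochner_Integration.integral_diff[OF F1(3) F2(3), symmetric])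
qed

text \<open>The sum over the families is carried through the integrals over \<open>w\<close> and
  \<open>z\<close>, and only at fixed \<open>w\<close> and \<open>z\<close> is it estimated. The
  factor \<open>norm w * L\<close> from the translation bound is then integrated against
  \<open>cmod (stft b a w)\<close>.\<close>

lemma sum_loc_op_difference_le:
  fixes a b :: "'a::euclidean_space \<Rightarrow> complex" and m :: "'a \<times> 'a \<Rightarrow> real"
    and e f :: "nat \<Rightarrow> 'a \<Rightarrow> complex"
  assumes a: "schwartz a" and b: "schwartz b" and a1: "energy a = 1" and b1: "energy b = 1"
    and m: "integrable lborel m"
    and L: "\<And>w. (\<integral>z. \<bar>m (z + w) - m z\<bar> \<partial>lborel) \<le> norm w * L"
    and e: "\<And>i. i < n \<Longrightarrow> sq_int (e i)"
    and eo: "\<And>i j. i < n \<Longrightarrow> j < n \<Longrightarrow> ip (e i) (e j) = (if i = j then 1 else 0)"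
    and f: "\<And>i. i < n \<Longrightarrow> sq_int (f i)"
    and fo: "\<And>i j. i < n \<Longrightarrow> j < n \<Longrightarrow> ip (f i) (f j) = (if i = j then 1 else 0)"
  shows "(\<Sum>i<n. cmod (l2_inner (\<lambda>t. loc_op a m (e i) t - loc_op b m (e i) t) (f i)))
    \<le> (\<integral>w. norm w * cmod (stft b a w) \<partial>lborel) * L"
proof -
  let ?V = "stft b a"
  note ab = schwartz_sq_int[OF a] schwartz_sq_int[OF b]
  define G where "G i w = (\<integral>z. complex_of_real (m z - m (z + w)) * cross a b (e i) (f i) w z \<partial>lborel)" for i w
  note [measurable] = borel_measurable_integrable[OF m, simplified]
  have D: "l2_inner (\<lambda>t. loc_op a m (e i) t - loc_op b m (e i) t) (f i) = (\<integral>w. ?V w * G i w \<partial>lborel)"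
    and DI: "integrable lborel (\<lambda>w. ?V w * G i w)" if i: "i < n" for i
  proof -
    note [measurable] = sq_int_measurable[OF e[OF i]] sq_int_measurable[OF f[OF i]]
    note la = loc_op_weak[OF ab(1) e[OF i] f[OF i] m] and lb = loc_op_weak[OF ab(2) e[OF i] f[OF i] m]
    note [measurable] = la(3) lb(3)
    note sd = spectrogram_difference[OF a b a1 b1 e[OF i] f[OF i] m, folded G_def]
    show "integrable lborel (\<lambda>w. ?V w * G i w)" by (rule sd)
    have "l2_inner (\<lambda>t. loc_op a m (e i) t - loc_op b m (e i) t) (f i)
      = (\<integral>t. (loc_op a m (e i) t - loc_op b m (e i) t) * cnj (f i t) \<partial>lborel)"
      unfolding l2_inner_def by (rule integral_completion) measurable
    also have "\<dots> = ip (loc_op a m (e i)) (f i) - ip (loc_op b m (e i)) (f i)"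
      using la(1) lb(1) by (simp add: left_diff_distrib)
    also have "\<dots> = (\<integral>w. ?V w * G i w \<partial>lborel)" unfolding la(2) lb(2) by (rule sd)
    finally show "l2_inner (\<lambda>t. loc_op a m (e i) t - loc_op b m (e i) t) (f i) = (\<integral>w. ?V w * G i w \<partial>lborel)" .
  qed
  \<comment> \<open>Each product is split by the arithmetic-geometric mean inequality, and Bessel is
    applied to \<open>e\<close> and to \<open>f\<close> separately. The shifted windows are unit
    vectors, so the sum is at most \<open>(1 + 1) / 2\<close>.\<close>
  have K1: "(\<Sum>i<n. cmod (cross a b (e i) (f i) w z)) \<le> 1" for w z
  proof -
    have st: "cmod (stft g (h i) z) = cmod (ip (tf_shift z g) (h i))" if "sq_int g" "sq_int (h i)"
      for g :: "'a \<Rightarrow> complex" and h :: "nat \<Rightarrow> 'a \<Rightarrow> complex" and i z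
      using that by (subst stft_eq_ip, simp add: sq_int_measurable, simp add: sq_int_measurable)
        (subst ip_commute, simp only: complex_mod_cnj)
    have "(\<Sum>i<n. cmod (cross a b (e i) (f i) w z))
      \<le> (\<Sum>i<n. ((cmod (ip (tf_shift z a) (e i)))\<^sup>2 + (cmod (ip (tf_shift (z + w) b) (f i)))\<^sup>2) / 2)"
    proof (rule sum_mono)
      fix i assume "i \<in> {..<n}"
      then have i: "i < n" by simp
      show "cmod (cross a b (e i) (f i) w z) \<le> ((cmod (ip (tf_shift z a) (e i)))\<^sup>2 + (cmod (ip (tf_shift (z + w) b) (f i)))\<^sup>2) / 2"
        unfolding norm_cross st[OF ab(1), of e i, OF e[OF i]] st[OF ab(2), of f i, OF f[OF i]]
        using sum_squares_bound[of "cmod (ip (tf_shift z a) (e i))" "cmod (ip (tf_shift (z + w) b) (f i))"]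
        by (subst pos_le_divide_eq) (simp_all add: mult_ac)
    qed
    also have "\<dots> = ((\<Sum>i<n. (cmod (ip (tf_shift z a) (e i)))\<^sup>2) + (\<Sum>i<n. (cmod (ip (tf_shift (z + w) b) (f i)))\<^sup>2)) / 2"
      by (simp add: sum.distrib sum_divide_distrib[symmetric])
    also have "\<dots> \<le> (energy (tf_shift z a) + energy (tf_shift (z + w) b)) / 2"
      by (intro divide_right_mono add_mono bessel e eo f fo sq_int_tf_shift ab) simp_all
    finally show ?thesis by (simp add: sq_int_tf_shift(2) ab a1 b1)
  qed
  have GL: "(\<Sum>i<n. cmod (G i w)) \<le> norm w * L" for w
  proof -
    have mw: "integrable lborel (\<lambda>z. m z - m (z + w))"
      using m by (simp add: lborel_translation(2)[of m])
    have ci: "integrable lborel (\<lambda>z. \<bar>m z - m (z + w)\<bar> * cmod (cross a b (e i) (f i) w z))" if i: "i < n" for i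
    proof (rule Bochner_Integration.integrable_bound[OF mw])
      note [measurable] = a[THEN schwartz_measurable] b[THEN schwartz_measurable] sq_int_measurable[OF e[OF i]] sq_int_measurable[OF f[OF i]]
      have "(\<lambda>(w, z). cross a b (e i) (f i) w z) \<in> borel_measurable (borel \<Otimes>\<^sub>M borel)" by (rule cross_measurable) measurable
      from measurable_compose[OF _ this, of "\<lambda>z. (w, z)" borel]
      have [measurable]: "cross a b (e i) (f i) w \<in> borel_measurable borel" by simp
      show "(\<lambda>z. \<bar>m z - m (z + w)\<bar> * cmod (cross a b (e i) (f i) w z)) \<in> borel_measurable lborel" by measurable
      have "cmod (cross a b (e i) (f i) w z) \<le> 1" for z
        using K1[of w z] member_le_sum[of i "{..<n}" "\<lambda>i. cmod (cross a b (e i) (f i) w z)"] i by auto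
      then show "AE z in lborel. norm (\<bar>m z - m (z + w)\<bar> * cmod (cross a b (e i) (f i) w z)) \<le> norm (m z - m (z + w))"
        by (simp add: abs_mult mult_left_le)
    qed
    have "(\<Sum>i<n. cmod (G i w)) \<le> (\<Sum>i<n. \<integral>z. \<bar>m z - m (z + w)\<bar> * cmod (cross a b (e i) (f i) w z) \<partial>lborel)"
    proof (rule sum_mono)
      fix i
      show "cmod (G i w) \<le> (\<integral>z. \<bar>m z - m (z + w)\<bar> * cmod (cross a b (e i) (f i) w z) \<partial>lborel)"
        unfolding G_def by (rule order_trans[OF integral_norm_bound]) (simp add: norm_mult del: of_real_diff)
    qed
    also have "\<dots> = (\<integral>z. (\<Sum>i<n. \<bar>m z - m (z + w)\<bar> * cmod (cross a b (e i) (f i) w z)) \<partial>lborel)"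
      by (rule Bochner_Integration.integral_sum[symmetric]) (use ci in auto)
    also have "\<dots> \<le> (\<integral>z. \<bar>m z - m (z + w)\<bar> \<partial>lborel)"
    proof (rule integral_mono)
      show "(\<Sum>i<n. \<bar>m z - m (z + w)\<bar> * cmod (cross a b (e i) (f i) w z)) \<le> \<bar>m z - m (z + w)\<bar>" for z
        using mult_left_mono[OF K1[of w z], of "\<bar>m z - m (z + w)\<bar>"] by (simp add: sum_distrib_left)
    qed (use ci mw in auto)
    also have "\<dots> \<le> norm w * L" using L[of w] by (simp add: abs_minus_commute)
    finally show ?thesis .
  qed
  have "(\<Sum>i<n. cmod (l2_inner (\<lambda>t. loc_op a m (e i) t - loc_op b m (e i) t) (f i)))
    \<le> (\<Sum>i<n. \<integral>w. cmod (?V w * G i w) \<partial>lborel)"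
    by (rule sum_mono) (simp only: D lessThan_iff integral_norm_bound)
  also have "\<dots> = (\<integral>w. (\<Sum>i<n. cmod (?V w * G i w)) \<partial>lborel)"
    by (rule Bochner_Integration.integral_sum[symmetric]) (use DI in auto)
  also have "\<dots> \<le> (\<integral>w. norm w * cmod (?V w) * L \<partial>lborel)"
  proof (rule integral_mono)
    show "integrable lborel (\<lambda>w. \<Sum>i<n. cmod (?V w * G i w))"
      by (intro Bochner_Integration.integrable_sum integrable_norm DI) simp
    show "integrable lborel (\<lambda>w. norm w * cmod (?V w) * L)"
      by (intro integrable_mult_left stft_integrable a b)
    show "(\<Sum>i<n. cmod (?V w * G i w)) \<le> norm w * cmod (?V w) * L" for w
      using mult_left_mono[OF GL[of w], of "cmod (?V w)"] by (simp add: norm_mult sum_distrib_left mult_ac)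
  qed
  finally show ?thesis by simp
qed

section \<open>Borel representatives and boundedness of the variation functional\<close>

lemma lebesgue_borel_representative:
  fixes f :: "'a::euclidean_space \<Rightarrow> complex"
  assumes "f \<in> borel_measurable lebesgue"
  obtains f' where "f' \<in> borel_measurable borel" "AE x in lborel. f x = f' x"
proof -
  have "(\<lambda>x. Re (f x)) \<in> borel_measurable lebesgue" "(\<lambda>x. Im (f x)) \<in> borel_measurable lebesgue"
    using assms by measurable
  then obtain r s where r: "r \<in> borel_measurable lborel" "AE x in lborel. Re (f x) = r x"
    and s: "s \<in> borel_measurable lborel" "AE x in lborel. Im (f x) = s x"
    using completion_ex_borel_measurable_real by metis
  have [measurable]: "r \<in> borel_measurable borel" "s \<in> borel_measurable borel" using r(1) s(1) by simp_all
  have "(\<lambda>x. of_real (r x) + \<i> * of_real (s x)) \<in> borel_measurable borel" by measurable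
  moreover have "AE x in lborel. f x = of_real (r x) + \<i> * of_real (s x)"
    using r(2) s(2) by eventually_elim (simp add: complex_eq_iff)
  ultimately show ?thesis using that by blast
qed

text \<open>A supremum of reals bounds its members only if the set is bounded above. Here each
  component \<open>\<phi> x \<bullet> i\<close> is a scalar test function with values in [-1, 1], so
  its pairing with the derivative measure is at most the total mass of \<open>\<mu> i\<close> and
  \<open>\<nu> i\<close>; the sum over the coordinates is a common bound.\<close>

lemma BV_bdd_above:
  fixes m :: "'a::euclidean_space \<Rightarrow> real"
  assumes "BV m"
  shows "bdd_above ((\<lambda>\<phi>. \<integral>x. m x * divergence \<phi> x \<partial>lebesgue) ` {\<phi>. C1c \<phi> \<and> (\<forall>x. norm (\<phi> x) \<le> 1)})"
proof -
  have m: "integrable lebesgue m" using assms by (simp add: BV_def)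
  \<comment> \<open>Bundling the conditions in one predicate lets the measures be chosen as
    functions of the coordinate direction.\<close>
  define P where "P i \<mu> \<nu> \<longleftrightarrow> finite_measure \<mu> \<and> finite_measure \<nu> \<and> sets \<mu> = sets borel \<and> sets \<nu> = sets borel \<and>
      (\<forall>\<phi>. C1c \<phi> \<longrightarrow> (\<integral>x. m x * frechet_derivative \<phi> (at x) i \<partial>lebesgue) = - ((\<integral>x. \<phi> x \<partial>\<mu>) - (\<integral>x. \<phi> x \<partial>\<nu>)))"
    for i and \<mu> \<nu> :: "'a measure"
  have "\<forall>i\<in>Basis. \<exists>\<mu> \<nu>. P i \<mu> \<nu>" using assms unfolding BV_def P_def by (rule conjunct2)
  then obtain \<mu> \<nu> where "\<And>i. i \<in> Basis \<Longrightarrow> P i (\<mu> i) (\<nu> i)" by metis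
  then have \<mu>: "\<And>i. i \<in> Basis \<Longrightarrow> finite_measure (\<mu> i)" "\<And>i. i \<in> Basis \<Longrightarrow> finite_measure (\<nu> i)"
    "\<And>i. i \<in> Basis \<Longrightarrow> sets (\<mu> i) = sets borel" "\<And>i. i \<in> Basis \<Longrightarrow> sets (\<nu> i) = sets borel"
    and I: "\<And>i \<phi>. i \<in> Basis \<Longrightarrow> C1c \<phi> \<Longrightarrow> (\<integral>x. m x * frechet_derivative \<phi> (at x) i \<partial>lebesgue)
             = - ((\<integral>x. \<phi> x \<partial>\<mu> i) - (\<integral>x. \<phi> x \<partial>\<nu> i))"
    unfolding P_def by blast+
  have fin: "\<bar>\<integral>x. \<phi> x \<partial>M\<bar> \<le> measure M (space M)"
    if "finite_measure M" "sets M = sets borel" "\<phi> \<in> borel_measurable borel" "\<And>x. \<bar>\<phi> x\<bar> \<le> 1"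
    for M and \<phi> :: "'a \<Rightarrow> real"
  proof -
    interpret finite_measure M by fact
    have [measurable]: "\<phi> \<in> borel_measurable M" using that(2,3) by (simp cong: measurable_cong_sets)
    have i: "integrable M \<phi>" by (rule integrable_const_bound[where B=1]) (use that(4) in auto)
    have "\<bar>\<integral>x. \<phi> x \<partial>M\<bar> \<le> (\<integral>x. \<bar>\<phi> x\<bar> \<partial>M)" by (rule integral_abs_bound)
    also have "\<dots> \<le> (\<integral>x. 1 \<partial>M)" by (rule integral_mono) (use that(4) i in auto)
    finally show ?thesis by simp
  qed
  show ?thesis
  proof (rule bdd_aboveI2)
    fix \<phi> :: "'a \<Rightarrow> 'a" assume "\<phi> \<in> {\<phi>. C1c \<phi> \<and> (\<forall>x. norm (\<phi> x) \<le> 1)}"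
    then have \<phi>: "C1c \<phi>" "\<And>x. norm (\<phi> x) \<le> 1" by auto
    define D where "D x = frechet_derivative \<phi> (at x)" for x
    have dD: "(\<phi> has_derivative D x) (at x)" for x using C1c_has_derivative[OF \<phi>(1)] by (simp add: D_def)
    have cD: "continuous_on UNIV (\<lambda>x. D x v)" for v using C1c_continuous_deriv[OF \<phi>(1)] by (simp add: D_def)
    obtain R where R: "\<And>x. norm x > R \<Longrightarrow> \<phi> x = 0" using C1c_support[OF \<phi>(1)] by metis
    have d: "((\<lambda>x. \<phi> x \<bullet> i) has_derivative (\<lambda>h. D x h \<bullet> i)) (at x)" for x i
      by (rule has_derivative_inner_left[OF dD])
    have C: "C1c (\<lambda>x. \<phi> x \<bullet> i)" for i
      by (rule C1cI[OF d, where R=R]) (auto intro!: continuous_intros cD simp: R)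
    have int: "integrable lebesgue (\<lambda>x. m x * (D x i \<bullet> i))" for i
    proof -
      obtain B where B: "\<And>x. norm (D x i) \<le> B" using C1c_deriv_bounded[OF \<phi>(1)] unfolding D_def by metis
      have "(\<lambda>x. D x i \<bullet> i) \<in> borel_measurable lborel"
        using borel_measurable_continuous_onI[OF cD[of i]] by simp
      then have [measurable]: "(\<lambda>x. D x i \<bullet> i) \<in> borel_measurable lebesgue" by (rule measurable_completion)
      note [measurable] = borel_measurable_integrable[OF m]
      show ?thesis
      proof (rule Bochner_Integration.integrable_bound)
        show "integrable lebesgue (\<lambda>x. m x * (B * norm i))" using m by simp
        have "\<bar>D x i \<bullet> i\<bar> \<le> \<bar>B * norm i\<bar>" for x
          using Cauchy_Schwarz_ineq2[of "D x i" i] mult_right_mono[OF B[of x], of "norm i"] by simp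
        then show "AE x in lebesgue. norm (m x * (D x i \<bullet> i)) \<le> norm (m x * (B * norm i))"
          by (intro AE_I2) (simp only: real_norm_def abs_mult mult_left_mono abs_ge_zero)
      qed measurable
    qed
    have "(\<integral>x. m x * divergence \<phi> x \<partial>lebesgue) = (\<integral>x. (\<Sum>i\<in>Basis. m x * (D x i \<bullet> i)) \<partial>lebesgue)"
      by (simp add: divergence_eq[OF dD] sum_distrib_left)
    also have "\<dots> = (\<Sum>i\<in>Basis. \<integral>x. m x * (D x i \<bullet> i) \<partial>lebesgue)"
      by (rule Bochner_Integration.integral_sum) (rule int)
    also have "\<dots> \<le> (\<Sum>i\<in>Basis. measure (\<mu> i) (space (\<mu> i)) + measure (\<nu> i) (space (\<nu> i)))"
    proof (rule sum_mono)
      fix i :: 'a assume i: "i \<in> Basis"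
      have m: "(\<lambda>x. \<phi> x \<bullet> i) \<in> borel_measurable borel"
        using C1c_continuous[OF C] by (rule borel_measurable_continuous_onI)
      have b: "\<bar>\<phi> x \<bullet> i\<bar> \<le> 1" for x using Basis_le_norm[OF i, of "\<phi> x"] \<phi>(2)[of x] by linarith
      have "(\<integral>x. m x * (D x i \<bullet> i) \<partial>lebesgue) = (\<integral>x. m x * frechet_derivative (\<lambda>x. \<phi> x \<bullet> i) (at x) i \<partial>lebesgue)"
        by (simp add: frechet_derivative_at[OF d, symmetric])
      also have "\<dots> = - ((\<integral>x. \<phi> x \<bullet> i \<partial>\<mu> i) - (\<integral>x. \<phi> x \<bullet> i \<partial>\<nu> i))" by (rule I[OF i C])
      also have "\<dots> \<le> measure (\<mu> i) (space (\<mu> i)) + measure (\<nu> i) (space (\<nu> i))"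
        using fin[OF \<mu>(1,3)[OF i] m b] fin[OF \<mu>(2,4)[OF i] m b] by linarith
      finally show "(\<integral>x. m x * (D x i \<bullet> i) \<partial>lebesgue) \<le> measure (\<mu> i) (space (\<mu> i)) + measure (\<nu> i) (space (\<nu> i))" .
    qed
    finally show "(\<integral>x. m x * divergence \<phi> x \<partial>lebesgue) \<le> (\<Sum>i\<in>Basis. measure (\<mu> i) (space (\<mu> i)) + measure (\<nu> i) (space (\<nu> i)))" .
  qed
qed

text \<open>This is the transfer from Borel to Lebesgue data. The symbol and both families are
  replaced by Borel functions that agree with them almost everywhere, which changes neither inner
  products nor the pairings that define \<open>var\<close>; then the estimate holds for every finite
  pair of families and hence for the supremum.\<close>

lemma trace_norm_loc_op_difference_le:
  fixes g1 g2 :: "'a::euclidean_space \<Rightarrow> complex" and m :: "'a \<times> 'a \<Rightarrow> real"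
  assumes g: "schwartz g1" "schwartz g2" and n: "l2_norm g1 = 1" "l2_norm g2 = 1" and m: "BV m"
  shows "trace_norm (\<lambda>f t. loc_op g1 m f t - loc_op g2 m f t)
    \<le> ereal ((\<integral>w. norm w * cmod (stft g2 g1 w) \<partial>lborel) * var m)"
proof -
  have mi: "integrable lebesgue m" using m by (simp add: BV_def)
  then have ml[measurable]: "m \<in> borel_measurable lebesgue" by auto
  obtain m' where m'b: "m' \<in> borel_measurable lborel" and mm': "AE x in lborel. m x = m' x"
    using completion_ex_borel_measurable_real[OF ml] by metis
  have [measurable]: "m' \<in> borel_measurable borel" using m'b by simp
  have m'l[measurable]: "m' \<in> borel_measurable lebesgue" using m'b by (rule measurable_completion)
  have mm'l: "AE x in lebesgue. m x = m' x" using mm' by (rule AE_completion)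
  have m'i: "integrable lborel m'"
  proof -
    have "integrable lebesgue m'" using mi mm'l by (subst integrable_cong_AE[symmetric, of m]) auto
    then show ?thesis using m'b by (simp add: integrable_completion)
  qed
  have energy1: "energy h = 1" if "schwartz h" "l2_norm h = 1" for h :: "'a \<Rightarrow> complex"
  proof -
    have [measurable]: "h \<in> borel_measurable borel" using that by (auto intro: schwartz_measurable)
    have "(\<integral>t. (cmod (h t))\<^sup>2 \<partial>lebesgue) = energy h" by (rule integral_completion) measurable
    then show ?thesis using that(2) by (simp add: l2_norm_def)
  qed
  have var: "(\<integral>x. m' x * divergence \<phi> x \<partial>lborel) \<le> var m" if \<phi>: "C1c \<phi>" "\<And>x. norm (\<phi> x) \<le> 1" for \<phi>
  proof -
    have "(\<lambda>x. frechet_derivative \<phi> (at x) i \<bullet> i) \<in> borel_measurable borel" for i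
      using borel_measurable_continuous_onI[OF C1c_continuous_deriv[OF \<phi>(1)]] by simp
    then have [measurable]: "divergence \<phi> \<in> borel_measurable borel" unfolding divergence_def by measurable
    have [measurable]: "divergence \<phi> \<in> borel_measurable lebesgue" by (rule measurable_completion) simp
    have "(\<integral>x. m' x * divergence \<phi> x \<partial>lborel) = (\<integral>x. m' x * divergence \<phi> x \<partial>lebesgue)"
      by (rule integral_completion[symmetric]) measurable
    also have "\<dots> = (\<integral>x. m x * divergence \<phi> x \<partial>lebesgue)"
      using mm'l by (intro integral_cong_AE) auto
    also have "\<dots> \<le> var m"
      unfolding var_def by (rule cSUP_upper[OF _ BV_bdd_above[OF m]]) (use \<phi> in auto)
    finally show ?thesis .
  qed
  have L: "(\<integral>z. \<bar>m' (z + w) - m' z\<bar> \<partial>lborel) \<le> norm w * var m" for w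
    by (rule integral_translation_diff_le[OF m'i var])
  have rep: "\<exists>h'. sq_int h' \<and> h' \<in> borel_measurable lebesgue \<and> (AE x in lebesgue. h x = h' x)" if "in_L2 h" for h :: "'a \<Rightarrow> complex"
  proof -
    have hm[measurable]: "h \<in> borel_measurable lebesgue" and hi: "integrable lebesgue (\<lambda>t. (cmod (h t))\<^sup>2)"
      using that by (auto simp: in_L2_def)
    obtain h' where h'[measurable]: "h' \<in> borel_measurable borel" and ae: "AE x in lborel. h x = h' x"
      using lebesgue_borel_representative[OF hm] .
    have h'l[measurable]: "h' \<in> borel_measurable lebesgue" by (rule measurable_completion) simp
    have ael: "AE x in lebesgue. h x = h' x" using ae by (rule AE_completion)
    have "integrable lebesgue (\<lambda>t. (cmod (h' t))\<^sup>2)"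
      using hi ael by (subst integrable_cong_AE[symmetric, of "\<lambda>t. (cmod (h t))\<^sup>2"]) auto
    then have "integrable lborel (\<lambda>t. (cmod (h' t))\<^sup>2)" by (subst (asm) integrable_completion) auto
    then have "sq_int h'" by (simp add: sq_int_def)
    then show ?thesis using h'l ael by blast
  qed
  have in_m: "h \<in> borel_measurable lebesgue" if "in_L2 h" for h :: "'a \<Rightarrow> complex" using that by (simp add: in_L2_def)
  have inner_cong: "l2_inner u v = l2_inner u' v'"
    if "u \<in> borel_measurable lebesgue" "v \<in> borel_measurable lebesgue" "u' \<in> borel_measurable lebesgue" "v' \<in> borel_measurable lebesgue"
      "AE x in lebesgue. u x = u' x" "AE x in lebesgue. v x = v' x" for u v u' v' :: "'a \<Rightarrow> complex"
  proof -
    note [measurable] = that(1-4)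
    have "AE x in lebesgue. u x * cnj (v x) = u' x * cnj (v' x)"
      using that(5,6) by eventually_elim simp
    then show ?thesis
      unfolding l2_inner_def by (intro integral_cong_AE) measurable
  qed
  show ?thesis
    unfolding trace_norm_def
  proof (rule SUP_least, clarsimp)
    fix n and e f :: "nat \<Rightarrow> 'a \<Rightarrow> complex"
    assume eo: "orthonormal_fam n e" and fo: "orthonormal_fam n f"
    have "\<forall>i. \<exists>h. i < n \<longrightarrow> sq_int h \<and> h \<in> borel_measurable lebesgue \<and> (AE x in lebesgue. e i x = h x)"
      using eo rep unfolding orthonormal_fam_def by meson
    then obtain e' where e': "\<And>i. i < n \<Longrightarrow> sq_int (e' i)" "\<And>i. i < n \<Longrightarrow> e' i \<in> borel_measurable lebesgue"
      "\<And>i. i < n \<Longrightarrow> AE x in lebesgue. e i x = e' i x" by metis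
    have "\<forall>i. \<exists>h. i < n \<longrightarrow> sq_int h \<and> h \<in> borel_measurable lebesgue \<and> (AE x in lebesgue. f i x = h x)"
      using fo rep unfolding orthonormal_fam_def by meson
    then obtain f' where f': "\<And>i. i < n \<Longrightarrow> sq_int (f' i)" "\<And>i. i < n \<Longrightarrow> f' i \<in> borel_measurable lebesgue"
      "\<And>i. i < n \<Longrightarrow> AE x in lebesgue. f i x = f' i x" by metis
    have em: "e i \<in> borel_measurable lebesgue" "f i \<in> borel_measurable lebesgue" if "i < n" for i
      using eo fo that in_m by (auto simp: orthonormal_fam_def)
    have ip_lebesgue: "l2_inner u v = ip u v" if "sq_int u" "sq_int v" for u v :: "'a \<Rightarrow> complex"
    proof -
      note [measurable] = that[THEN sq_int_measurable]
      show ?thesis unfolding l2_inner_def by (rule integral_completion) measurable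
    qed
    have e'o: "ip (e' i) (e' j) = (if i = j then 1 else 0)" if "i < n" "j < n" for i j
      using inner_cong[OF em(1) em(1) e'(2) e'(2) e'(3) e'(3)] that eo ip_lebesgue[OF e'(1) e'(1)]
      by (simp add: orthonormal_fam_def)
    have f'o: "ip (f' i) (f' j) = (if i = j then 1 else 0)" if "i < n" "j < n" for i j
      using inner_cong[OF em(2) em(2) f'(2) f'(2) f'(3) f'(3)] that fo ip_lebesgue[OF f'(1) f'(1)]
      by (simp add: orthonormal_fam_def)
    \<comment> \<open>Symbol and argument occur only under integrals, so the two functions coincide
      at every point and not merely almost everywhere.\<close>
    have loc: "loc_op h m (e i) = loc_op h m' (e' i)" if h: "schwartz h" and i: "i < n" for h i
    proof -
      have hb: "h \<in> borel_measurable borel" using schwartz_measurable[OF h] .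
      have ts: "tf_shift z h \<in> borel_measurable lebesgue" for z
        by (rule measurable_completion) (use tf_shift_measurable(2)[OF hb] in simp)
      have st: "stft h (e i) z = stft h (e' i) z" for z
        unfolding stft_def by (rule inner_cong) (use em(1)[OF i] e'[OF i] ts in auto)
      have "(\<lambda>z. stft h (e' i) z * tf_shift z h t) \<in> borel_measurable lborel" for t
      proof -
        note [measurable] = hb stft_measurable[OF sq_int_measurable[OF e'(1)[OF i]] hb]
        show ?thesis unfolding tf_shift_eq by measurable
      qed
      then have [measurable]: "(\<lambda>z. stft h (e' i) z * tf_shift z h t) \<in> borel_measurable lebesgue" for t
        by (rule measurable_completion)
      show ?thesis
      proof (rule ext)
        fix t
        have "AE z in lebesgue. complex_of_real (m z) * (stft h (e' i) z * tf_shift z h t)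
          = complex_of_real (m' z) * (stft h (e' i) z * tf_shift z h t)"
          using mm'l by eventually_elim simp
        then show "loc_op h m (e i) t = loc_op h m' (e' i) t"
          unfolding loc_op_def st mult.assoc by (intro integral_cong_AE) measurable
      qed
    qed
    have "l2_inner (\<lambda>t. loc_op g1 m (e i) t - loc_op g2 m (e i) t) (f i)
      = l2_inner (\<lambda>t. loc_op g1 m' (e' i) t - loc_op g2 m' (e' i) t) (f' i)" if i: "i < n" for i
    proof -
      have "loc_op h m' (e' i) \<in> borel_measurable borel" if "schwartz h" for h
        by (rule loc_op_weak(3)[OF schwartz_sq_int[OF that] e'(1)[OF i] f'(1)[OF i] m'i])
      from this[OF g(1)] this[OF g(2)]
      have "(\<lambda>t. loc_op g1 m' (e' i) t - loc_op g2 m' (e' i) t) \<in> borel_measurable lebesgue"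
        by (intro measurable_completion) simp
      then show ?thesis
        unfolding loc[OF g(1) i] loc[OF g(2) i] by (intro inner_cong) (use em(2)[OF i] f'[OF i] in auto)
    qed
    then have "(\<Sum>i<n. cmod (l2_inner (\<lambda>t. loc_op g1 m (e i) t - loc_op g2 m (e i) t) (f i)))
      = (\<Sum>i<n. cmod (l2_inner (\<lambda>t. loc_op g1 m' (e' i) t - loc_op g2 m' (e' i) t) (f' i)))"
      by simp
    also have "\<dots> \<le> (\<integral>w. norm w * cmod (stft g2 g1 w) \<partial>lborel) * var m"
      by (rule sum_loc_op_difference_le[OF g energy1[OF g(1) n(1)] energy1[OF g(2) n(2)] m'i L e'(1) e'o f'(1) f'o])
    finally show "(\<Sum>i<n. cmod (l2_inner (\<lambda>t. loc_op g1 m (e i) t - loc_op g2 m (e i) t) (f i)))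
      \<le> (\<integral>w. norm w * cmod (stft g2 g1 w) \<partial>lborel) * var m" .
  qed
qed

text \<open>The constant is
  \<open>\<integral>w. norm w * cmod (stft g2 g1 w) \<partial>lborel\<close>. It is fixed before the
  symbol, and the claim for sets is the instance where the symbol is an indicator function.\<close>

theorem theorem5p3:
  fixes g1 g2 :: "'a::euclidean_space \<Rightarrow> complex"
  assumes "schwartz g1" and "schwartz g2"
    and "l2_norm g1 = 1" and "l2_norm g2 = 1"
  shows "\<exists>C::real.
     (\<forall>m :: 'a \<times> 'a \<Rightarrow> real. BV m \<longrightarrow>
        trace_norm (\<lambda>f t. loc_op g1 m f t - loc_op g2 m f t) \<le> ereal (C * var m)) \<and>
     (\<forall>\<Omega> :: ('a \<times> 'a) set. \<Omega> \<in> sets lebesgue \<and> emeasure lebesgue \<Omega> < \<infinity> \<and>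
        BV (indicator \<Omega>) \<longrightarrow>
        trace_norm (\<lambda>f t. loc_op g1 (indicator \<Omega>) f t - loc_op g2 (indicator \<Omega>) f t)
          \<le> ereal (C * var (indicator \<Omega>)))"
  using trace_norm_loc_op_difference_le[OF assms] by blast

end
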